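(* Let $\sigma\in\mathrm{Aut}(G)$. Then for every $s\in\widehat{K}$ there exists $s'\in\widehat{K}$ such that $\sigma(G(s))=G(s')$.
   Context: Let $\mathbb{F}_q$ be a finite field and $K$ an algebraic function field in one variable with constant field $\mathbb{F}_q$. Fix a place $\infty$ of $K$ and let $A$ be the ring of elements of $K$ that are integral (regular) at every place other than $\infty$; $A$ is a Dedekind domain with $A^*=\mathbb{F}_q^*$. Let $G=GL_2(A)$, acting on $\widehat{K}=\mathbb{P}^1(K)=K\cup\{\infty\}$ by Möbius transformations. For $s\in\widehat{K}$, $G(s)$ denotes the stabilizer of $s$ in $G$. *)

theory Defs
  imports
    "HOL-Analysis.Determinants"
    "HOL-Analysis.Complex_Transcendental"
    "HOL-Algebra.Algebra"
    "HOL-Algebra.Algebraic_Closure_Type"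
begin

abbreviation field_ring :: "'k::field ring"
  where "field_ring \<equiv> ring_of_type_algebra"

text \<open>The whole type \<open>'k\<close> is an algebraic function field in one variable over \<open>F\<close>, and \<open>F\<close>
  is its full field of constants: \<open>'k\<close> has finite degree over \<open>F(x)\<close> for some \<open>x\<close> that is
  transcendental over \<open>F\<close>, and \<open>F\<close> is algebraically closed in \<open>'k\<close>.\<close>

definition function_field_with_constants :: "'k::field set \<Rightarrow> bool" where
  "function_field_with_constants F \<longleftrightarrow>
     subfield F (field_ring :: 'k ring) \<and>
     (\<exists>x. ring.transcendental (field_ring :: 'k ring) F x \<and>
          ring.finite_dimension (field_ring :: 'k ring)
            (generate_field (field_ring :: 'k ring) (insert x F)) UNIV) \<and>
     (\<forall>x. \<not> ring.transcendental (field_ring :: 'k ring) F x \<longrightarrow> x \<in> F)"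

definition valuation_ring :: "'k::field set \<Rightarrow> 'k set \<Rightarrow> bool" where
  "valuation_ring F V \<longleftrightarrow>
     subring V (field_ring :: 'k ring) \<and> F \<subset> V \<and> V \<subset> UNIV \<and> (\<forall>z. z \<in> V \<or> inverse z \<in> V)"

definition nonunits :: "'k::field set \<Rightarrow> 'k set" where
  "nonunits V = {x \<in> V. \<not> (\<exists>y\<in>V. x * y = 1)}"

text \<open>A place is the maximal ideal of a valuation ring of the function field. The valuation
  ring is determined by the place, so the existential quantifier in \<open>regular_at\<close> ranges over
  at most one ring.\<close>

definition place :: "'k::field set \<Rightarrow> 'k set \<Rightarrow> bool" where
  "place F P \<longleftrightarrow> (\<exists>V. valuation_ring F V \<and> P = nonunits V)"

definition regular_at :: "'k::field set \<Rightarrow> 'k set \<Rightarrow> 'k \<Rightarrow> bool" where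
  "regular_at F P x \<longleftrightarrow> (\<exists>V. valuation_ring F V \<and> P = nonunits V \<and> x \<in> V)"

definition regular_away_from :: "'k::field set \<Rightarrow> 'k set \<Rightarrow> 'k set" where
  "regular_away_from F Pinf = {x. \<forall>P. place F P \<and> P \<noteq> Pinf \<longrightarrow> regular_at F P x}"

definition mat2_monoid :: "'k::field set \<Rightarrow> ('k ^ 2 ^ 2) monoid" where
  "mat2_monoid A = \<lparr>carrier = {M. \<forall>i j. M $ i $ j \<in> A}, mult = (**), one = mat 1\<rparr>"

definition GL2 :: "'k::field set \<Rightarrow> ('k ^ 2 ^ 2) monoid" where
  "GL2 A = units_of (mat2_monoid A)"

datatype 'k proj_line = Fin 'k | Infty

text \<open>Only the values at invertible matrices are meaningful.\<close>

fun mobius_act :: "'k::field ^ 2 ^ 2 \<Rightarrow> 'k proj_line \<Rightarrow> 'k proj_line" where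
  "mobius_act M (Fin z) =
     (if M $ 2 $ 1 * z + M $ 2 $ 2 = 0 then Infty
      else Fin (moebius (M $ 1 $ 1) (M $ 1 $ 2) (M $ 2 $ 1) (M $ 2 $ 2) z))"
| "mobius_act M Infty =
     (if M $ 2 $ 1 = 0 then Infty else Fin (M $ 1 $ 1 / M $ 2 $ 1))"

end

theory Submission
  imports Defs
begin

hide_const (open) UnivPoly.coeff UnivPoly.monom Polynomials.degree Polynomials.lead_coeff

text \<open>Let \<open>u \<noteq> 1\<close> be a unipotent element of \<open>GL\<^sub>2(A)\<close> with fixed point \<open>s\<close>. For any \<open>g\<close> the matrix
  \<open>g u g\<inverse>\<close> is unipotent with fixed point \<open>g s\<close>, and two nontrivial unipotents commute exactly when
  their fixed points agree. So the stabilizer of \<open>s\<close> is the set of \<open>g\<close> such that \<open>g u g\<inverse>\<close> commutes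
  with \<open>u\<close>, and an automorphism \<open>\<sigma>\<close> maps it to the analogous set for \<open>\<sigma> u\<close>. The latter is again
  unipotent: in characteristic \<open>p\<close> the unipotents are the elements with \<open>u ^ p = 1\<close>.

  It remains to find a nontrivial unipotent fixing a given \<open>s\<close>. For \<open>s = a / c\<close> with \<open>a, c \<in> A\<close> one
  takes \<open>1 + ((-ac, a\<^sup>2), (-c\<^sup>2, ac))\<close>, so the point is that \<open>K\<close> is the field of fractions of \<open>A\<close>. Since
  \<open>K\<close> is algebraic over \<open>F(b)\<close> for every nonconstant \<open>b\<close>, this reduces to the existence of an element
  \<open>b\<close> whose only pole is the given place. To find it, take \<open>t\<close> with a pole there. Weak approximation,
  in a form that needs only the finiteness of \<open>K\<close> over \<open>F(t)\<close>, gives \<open>z\<close> that has a pole at the place but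
  none at the other poles of \<open>t\<close>. The poles of \<open>z\<close> outside those of \<open>t\<close> are removed by the
  pigeonhole principle: modulo functions regular at the poles of \<open>t\<close>, and functions regular elsewhere,
  the powers of \<open>z\<close> fall into finitely many classes.\<close>

section \<open>Counting and algebraic dependence\<close>

definition ring_set :: "'k::field set \<Rightarrow> bool" where
  "ring_set A \<longleftrightarrow> 1 \<in> A \<and> (\<forall>x\<in>A. \<forall>y\<in>A. x - y \<in> A \<and> x * y \<in> A)"

definition polys_over :: "'k::field set \<Rightarrow> 'k poly set" where
  "polys_over A = {p. \<forall>i. coeff p i \<in> A}"

context
  fixes A :: "'k::field set"
  assumes A: "ring_set A"
begin

lemma ring_set_closed:
  "0 \<in> A" "1 \<in> A" "x \<in> A \<Longrightarrow> - x \<in> A" "x \<in> A \<Longrightarrow> y \<in> A \<Longrightarrow> x + y \<in> A"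
  "x \<in> A \<Longrightarrow> y \<in> A \<Longrightarrow> x - y \<in> A" "x \<in> A \<Longrightarrow> y \<in> A \<Longrightarrow> x * y \<in> A"
proof -
  have *: "1 \<in> A" "\<And>x y. x \<in> A \<Longrightarrow> y \<in> A \<Longrightarrow> x - y \<in> A" "\<And>x y. x \<in> A \<Longrightarrow> y \<in> A \<Longrightarrow> x * y \<in> A"
    using A by (auto simp: ring_set_def)
  show 0: "0 \<in> A" using *(2)[OF *(1) *(1)] by simp
  show neg: "- x \<in> A" if "x \<in> A" for x using *(2)[OF 0 that] by simp
  show "x + y \<in> A" if "x \<in> A" "y \<in> A" using *(2)[OF that(1) neg[OF that(2)]] by simp
qed (use A in \<open>auto simp: ring_set_def\<close>)

lemma ring_set_sum: "(\<And>i. i \<in> I \<Longrightarrow> f i \<in> A) \<Longrightarrow> sum f I \<in> A"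
  by (induction I rule: infinite_finite_induct) (auto intro: ring_set_closed)

lemma ring_set_power: "x \<in> A \<Longrightarrow> x ^ n \<in> A"
  by (induction n) (auto intro: ring_set_closed)

lemma polys_over_closed:
  "0 \<in> polys_over A" "1 \<in> polys_over A"
  "p \<in> polys_over A \<Longrightarrow> q \<in> polys_over A \<Longrightarrow> p + q \<in> polys_over A"
  "p \<in> polys_over A \<Longrightarrow> q \<in> polys_over A \<Longrightarrow> p - q \<in> polys_over A"
  "p \<in> polys_over A \<Longrightarrow> q \<in> polys_over A \<Longrightarrow> p * q \<in> polys_over A"
  "p \<in> polys_over A \<Longrightarrow> - p \<in> polys_over A"
  "a \<in> A \<Longrightarrow> p \<in> polys_over A \<Longrightarrow> pCons a p \<in> polys_over A"
  "a \<in> A \<Longrightarrow> monom a n \<in> polys_over A"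
  "p \<in> polys_over A \<Longrightarrow> poly_shift n p \<in> polys_over A"
  by (auto simp: polys_over_def coeff_mult coeff_pCons coeff_poly_shift
      intro!: ring_set_closed ring_set_sum split: nat.split)

lemma polys_over_sum: "(\<And>i. i \<in> I \<Longrightarrow> f i \<in> polys_over A) \<Longrightarrow> sum f I \<in> polys_over A"
  by (induction I rule: infinite_finite_induct) (auto intro: polys_over_closed)

lemma poly_in_ring_set: "p \<in> polys_over A \<Longrightarrow> y \<in> A \<Longrightarrow> poly p y \<in> A"
  unfolding poly_altdef
  by (intro ring_set_sum ring_set_closed ring_set_power) (auto simp: polys_over_def)

end

lemma finite_polys_over_degree_le:
  fixes F :: "'k::field set"
  assumes "finite F"
  shows "finite {p \<in> polys_over F. degree p \<le> m}"
    "card {p \<in> polys_over F. degree p \<le> m} \<le> card F ^ Suc m"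
proof -
  have sub: "{p \<in> polys_over F. degree p \<le> m} \<subseteq>
      (\<lambda>a. \<Sum>k\<le>m. monom (a k) k) ` ({..m} \<rightarrow>\<^sub>E F)" (is "_ \<subseteq> ?S")
  proof clarify
    fix p assume p: "p \<in> polys_over F" "degree p \<le> m"
    then have "p = (\<Sum>k\<le>m. monom (restrict (coeff p) {..m} k) k)"
      by (simp add: poly_as_sum_of_monoms')
    moreover have "restrict (coeff p) {..m} \<in> {..m} \<rightarrow>\<^sub>E F"
      using p by (auto simp: polys_over_def)
    ultimately show "p \<in> ?S" by blast
  qed
  have fin: "finite ({..m} \<rightarrow>\<^sub>E F)" using assms by (simp add: finite_PiE)
  show "finite {p \<in> polys_over F. degree p \<le> m}"
    using sub fin finite_subset by blast
  have "card {p \<in> polys_over F. degree p \<le> m} \<le> card ({..m} \<rightarrow>\<^sub>E F)"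
    using surj_card_le[OF fin sub] .
  then show "card {p \<in> polys_over F. degree p \<le> m} \<le> card F ^ Suc m"
    by (simp add: card_PiE)
qed

section \<open>Spaces of bounded degree in a finite extension of \<open>F(x)\<close>\<close>

locale finite_constants =
  fixes F :: "'k::field set"
  assumes ring_F: "ring_set F"
    and inverse_F: "a \<in> F \<Longrightarrow> inverse a \<in> F"
    and finite_F: "finite F"
begin

lemmas F_closed = ring_set_closed[OF ring_F]
lemmas PF_closed = polys_over_closed[OF ring_F] polys_over_sum[OF ring_F]

lemma card_F: "card F > 1"
proof -
  have "card {0, 1 :: 'k} \<le> card F"
    by (rule card_mono[OF finite_F]) (auto intro: F_closed)
  then show ?thesis by simp
qed

end

text \<open>The assumption says that the \<open>b j\<close> span the field over \<open>F(x)\<close>,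
  in denominator-free form, so that everything below can be counted in \<open>F[x]\<close>.\<close>

locale function_field = finite_constants +
  fixes x :: "'k::field" and b :: "nat \<Rightarrow> 'k" and d :: nat
  assumes span: "\<exists>q p. q \<in> polys_over F \<and> poly q x \<noteq> 0 \<and> (\<forall>j. p j \<in> polys_over F) \<and>
      poly q x * z = (\<Sum>j<d. poly (p j) x * b j)"
begin

text \<open>The \<open>L m\<close> play the role of Riemann--Roch spaces: they exhaust \<open>K\<close> up to denominators in \<open>F[x]\<close>,
  and their size is controlled.\<close>

definition L :: "nat \<Rightarrow> 'k set" where
  "L m = {(\<Sum>j<d. poly (p j) x * b j) | p. \<forall>j. p j \<in> polys_over F \<and> degree (p j) \<le> m}"

lemma card_L: "finite (L m)" "card (L m) \<le> card F ^ (Suc m * d)"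
proof -
  define P where "P = {p \<in> polys_over F. degree p \<le> m}"
  define S where "S = (\<lambda>p. \<Sum>j<d. poly (p j) x * b j) ` ({..<d} \<rightarrow>\<^sub>E P)"
  have P: "finite P" "card P \<le> card F ^ Suc m"
    unfolding P_def by (rule finite_polys_over_degree_le[OF finite_F])+
  have fin: "finite ({..<d} \<rightarrow>\<^sub>E P)" using P by (simp add: finite_PiE)
  have sub: "L m \<subseteq> S"
  proof
    fix l assume "l \<in> L m"
    then obtain p where p: "\<And>j. p j \<in> P" "l = (\<Sum>j<d. poly (p j) x * b j)"
      by (auto simp: L_def P_def)
    have "l = (\<Sum>j<d. poly (restrict p {..<d} j) x * b j)" unfolding p(2) by simp
    moreover have "restrict p {..<d} \<in> {..<d} \<rightarrow>\<^sub>E P" using p(1) by auto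
    ultimately show "l \<in> S" unfolding S_def by blast
  qed
  show "finite (L m)" using sub fin finite_subset unfolding S_def by blast
  have "card (L m) \<le> card ({..<d} \<rightarrow>\<^sub>E P)"
    using surj_card_le[OF fin] sub unfolding S_def .
  also have "\<dots> = card P ^ d" by (simp add: card_PiE)
  also have "\<dots> \<le> (card F ^ Suc m) ^ d" by (rule power_mono[OF P(2)]) simp
  finally show "card (L m) \<le> card F ^ (Suc m * d)" unfolding power_mult .
qed

lemma L_mono: "m \<le> m' \<Longrightarrow> L m \<subseteq> L m'"
  unfolding L_def by (blast intro: order_trans)

lemma L_add: "l \<in> L m \<Longrightarrow> l' \<in> L m \<Longrightarrow> l + l' \<in> L m"
proof -
  assume "l \<in> L m" "l' \<in> L m"
  then obtain p p' where "\<forall>j. p j \<in> polys_over F \<and> degree (p j) \<le> m" "l = (\<Sum>j<d. poly (p j) x * b j)"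
    "\<forall>j. p' j \<in> polys_over F \<and> degree (p' j) \<le> m" "l' = (\<Sum>j<d. poly (p' j) x * b j)"
    by (auto simp: L_def)
  then show ?thesis
    unfolding L_def
    by (auto intro!: exI[of _ "\<lambda>j. p j + p' j"] PF_closed degree_add_le
        simp: sum.distrib algebra_simps)
qed

lemma L_sum: "(\<And>i. i \<in> I \<Longrightarrow> f i \<in> L m) \<Longrightarrow> sum f I \<in> L m"
proof (induction I rule: infinite_finite_induct)
  case (insert i I)
  then show ?case by (auto intro: L_add)
qed (auto simp: L_def intro!: exI[of _ "\<lambda>j. 0"] PF_closed)

lemma L_mult:
  assumes "l \<in> L m" "q \<in> polys_over F" "degree q \<le> e"
  shows "poly q x * l \<in> L (e + m)"
proof -
  obtain p where p: "\<And>j. p j \<in> polys_over F \<and> degree (p j) \<le> m" "l = (\<Sum>j<d. poly (p j) x * b j)"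
    using assms by (auto simp: L_def)
  have "degree (q * p j) \<le> e + m" for j
    using degree_mult_le[of q "p j"] p(1)[of j] assms(3) by linarith
  then show ?thesis
    unfolding L_def using p assms
    by (auto intro!: exI[of _ "\<lambda>j. q * p j"] PF_closed simp: sum_distrib_left mult.assoc)
qed

text \<open>Each element has its own denominator by \<open>span\<close>; these are multiplied
  together, and an extra factor only raises the degree bound.\<close>

lemma common_denominator:
  assumes "finite Z"
  shows "\<exists>q c. q \<in> polys_over F \<and> poly q x \<noteq> 0 \<and> (\<forall>z\<in>Z. poly q x * z \<in> L c)"
  using assms
proof induction
  case empty
  show ?case by (intro exI[of _ 1]) (auto intro: PF_closed)
next
  case (insert z Z)
  then obtain q c where q: "q \<in> polys_over F" "poly q x \<noteq> 0" "\<And>z. z \<in> Z \<Longrightarrow> poly q x * z \<in> L c"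
    by auto
  obtain q' p where q': "q' \<in> polys_over F" "poly q' x \<noteq> 0" "\<And>j. p j \<in> polys_over F"
    "poly q' x * z = (\<Sum>j<d. poly (p j) x * b j)"
    using span[of z] by blast
  define c' where "c' = (\<Sum>j<d. degree (p j))"
  \<comment> \<open>The bound \<open>c'\<close> sees only the indices below \<open>d\<close>,
    whereas \<open>L\<close> bounds the degree at every index, so \<open>p\<close> is replaced by 0
    from \<open>d\<close> on.\<close>
  have "poly q' x * z = (\<Sum>j<d. poly (if j < d then p j else 0) x * b j)"
    using q' by simp
  moreover have "degree (if j < d then p j else 0) \<le> c'" for j
    by (auto simp: c'_def intro: member_le_sum)
  ultimately have L': "poly q' x * z \<in> L c'"
    unfolding L_def using q'(3) by (auto intro!: exI[of _ "\<lambda>j. if j < d then p j else 0"] PF_closed)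
  define C where "C = degree q + degree q' + c + c'"
  have "poly (q * q') x * z' \<in> L C" if "z' \<in> insert z Z" for z'
  proof (cases "z' = z")
    case True
    have "poly q x * (poly q' x * z) \<in> L (degree q + c')"
      by (rule L_mult[OF L' q(1)]) simp
    then show ?thesis using L_mono[of "degree q + c'" C] True by (auto simp: C_def mult.assoc)
  next
    case False
    have "poly q' x * (poly q x * z') \<in> L (degree q' + c)"
      by (rule L_mult[OF q(3) q'(1)]) (use that False in auto)
    then show ?thesis using L_mono[of "degree q' + c" C] by (auto simp: C_def mult_ac)
  qed
  then show ?case
    using q q' by (intro exI[of _ "q * q'"] exI[of _ C]) (auto intro: PF_closed)
qed

text \<open>It suffices to clear the denominators of the products \<open>y * b j\<close>. The shift
  \<open>c\<close> is the same for all \<open>m\<close>, so the degree growth under powers of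
  \<open>y\<close> is linear in the exponent.\<close>

lemma mult_bounded:
  "\<exists>q c. q \<in> polys_over F \<and> poly q x \<noteq> 0 \<and> degree q \<le> c \<and> (\<forall>m. \<forall>l\<in>L m. poly q x * y * l \<in> L (c + m))"
proof -
  obtain q c where q: "q \<in> polys_over F" "poly q x \<noteq> 0"
    "\<And>j. j < d \<Longrightarrow> poly q x * (y * b j) \<in> L c"
    using common_denominator[of "(\<lambda>j. y * b j) ` {..<d}"] by auto
  have "poly q x * y * l \<in> L (c + m)" if l: "l \<in> L m" for l m
  proof -
    obtain p where p: "\<And>j. p j \<in> polys_over F \<and> degree (p j) \<le> m" "l = (\<Sum>j<d. poly (p j) x * b j)"
      using l by (auto simp: L_def)
    have "poly q x * y * l = (\<Sum>j<d. poly (p j) x * (poly q x * (y * b j)))"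
      unfolding p(2) by (simp add: sum_distrib_left mult_ac)
    also have "\<dots> \<in> L (m + c)"
      by (rule L_sum, rule L_mult) (use p q in auto)
    finally show ?thesis by (simp add: add.commute)
  qed
  then have "poly q x * y * l \<in> L (c + degree q + m)" if "l \<in> L m" for l m
    using L_mono[of "c + m" "c + degree q + m"] that by auto
  with q show ?thesis by (intro exI[of _ q] exI[of _ "c + degree q"]) auto
qed

text \<open>Surplus factors \<open>poly q x\<close> are absorbed when \<open>k < M\<close>, so that
  all powers of \<open>y\<close> up to \<open>M\<close> share the denominator
  \<open>poly q x ^ M\<close>.\<close>

lemma power_mult_bounded:
  assumes q: "q \<in> polys_over F" "degree q \<le> c" "\<And>m l. l \<in> L m \<Longrightarrow> poly q x * y * l \<in> L (c + m)"
    and "k \<le> M" "l \<in> L m"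
  shows "poly q x ^ M * y ^ k * l \<in> L (M * c + m)"
  using assms(4)
proof (induction M arbitrary: k)
  case 0
  with assms(5) show ?case by simp
next
  case (Suc M)
  show ?case
  proof (cases k)
    case 0
    have "poly q x * (poly q x ^ M * y ^ 0 * l) \<in> L (c + (M * c + m))"
      by (rule L_mult[OF Suc.IH q(1) q(2)]) simp
    then show ?thesis using 0 by (simp add: add_ac mult_ac)
  next
    case (Suc k')
    have "poly q x * y * (poly q x ^ M * y ^ k' * l) \<in> L (c + (M * c + m))"
      by (rule q(3)[OF Suc.IH]) (use Suc Suc.prems in auto)
    then show ?thesis using Suc by (simp add: add_ac mult_ac)
  qed
qed

text \<open>Any \<open>y\<close> makes the field finite over \<open>F(y)\<close>, by counting: the sums
  \<open>\<Sum>i\<le>n. f i (y) * z i\<close> with \<open>deg f i \<le> M\<close> number about \<open>card F ^ ((n + 1) * M)\<close>, but after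
  clearing denominators they lie in \<open>L (C + M * c)\<close>, of size at most \<open>card F ^ (d * (C + M * c + 1))\<close>.\<close>

lemma dependent_over_polys:
  "\<exists>n. \<forall>z :: nat \<Rightarrow> 'k. \<exists>f. (\<forall>i. f i \<in> polys_over F) \<and> (\<exists>i\<le>n. f i \<noteq> 0) \<and>
     (\<Sum>i\<le>n. poly (f i) y * z i) = 0"
proof -
  obtain q c where q: "q \<in> polys_over F" "poly q x \<noteq> 0" "degree q \<le> c"
    "\<And>m l. l \<in> L m \<Longrightarrow> poly q x * y * l \<in> L (c + m)"
    using mult_bounded by blast
  \<comment> \<open>\<open>n\<close> must not depend on \<open>z\<close>. With this \<open>n\<close>
    and \<open>M = Suc C * d\<close> below, the coefficient families number \<open>card F\<close> to
    the power \<open>Suc n * Suc M\<close>, while the target has exponent at most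
    \<open>n * M + M\<close>.\<close>
  define n where "n = c * d"
  have "\<exists>f. (\<forall>i. f i \<in> polys_over F) \<and> (\<exists>i\<le>n. f i \<noteq> 0) \<and>
     (\<Sum>i\<le>n. poly (f i) y * z i) = 0" for z :: "nat \<Rightarrow> 'k"
  proof -
    obtain q' C where q': "q' \<in> polys_over F" "poly q' x \<noteq> 0" "\<And>i. i \<le> n \<Longrightarrow> poly q' x * z i \<in> L C"
      using common_denominator[of "z ` {..n}"] by auto
    define M where "M = Suc C * d"
    define D where "D = poly q x ^ M * poly q' x"
    have D0: "D \<noteq> 0" using q q' by (simp add: D_def)
    define S where "S = ({..n} \<times> {..M}) \<rightarrow>\<^sub>E F"
    define \<phi> where "\<phi> a = (\<Sum>(i,k)\<in>{..n}\<times>{..M}. a (i,k) * y ^ k * z i)" for a :: "nat \<times> nat \<Rightarrow> 'k"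
    have "D * \<phi> a \<in> L (M * c + C)" if "a \<in> S" for a
    proof -
      have "D * \<phi> a = (\<Sum>(i,k)\<in>{..n}\<times>{..M}. poly [:a (i,k):] x * (poly q x ^ M * y ^ k * (poly q' x * z i)))"
        unfolding D_def \<phi>_def sum_distrib_left by (rule sum.cong) (auto simp: mult_ac)
      also have "\<dots> \<in> L (0 + (M * c + C))"
      proof (rule L_sum)
        fix ik assume "ik \<in> {..n} \<times> {..M}"
        then obtain i k where ik_eq: "ik = (i, k)" and ik: "i \<in> {..n}" "k \<in> {..M}" by blast
        have "a (i,k) \<in> F" using PiE_mem[OF that[unfolded S_def], of "(i,k)"] ik by simp
        then have 1: "[:a (i,k):] \<in> polys_over F" by (intro PF_closed)
        have 2: "poly q' x * z i \<in> L C" using q'(3) ik by simp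
        have "poly q x ^ M * y ^ k * (poly q' x * z i) \<in> L (M * c + C)"
          by (rule power_mult_bounded[OF q(1,3,4) _ 2]) (use ik in auto)
        from L_mult[OF this 1, of 0]
        show "(case ik of (i, k) \<Rightarrow> poly [:a (i,k):] x * (poly q x ^ M * y ^ k * (poly q' x * z i)))
            \<in> L (0 + (M * c + C))"
          by (simp add: ik_eq)
      qed
      finally show ?thesis by simp
    qed
    then have sub: "(\<lambda>a. D * \<phi> a) ` S \<subseteq> L (M * c + C)" by auto
    have "\<not> inj_on (\<lambda>a. D * \<phi> a) S"
    proof
      assume "inj_on (\<lambda>a. D * \<phi> a) S"
      then have "card S \<le> card (L (M * c + C))"
        by (rule card_inj_on_le[OF _ sub card_L(1)])
      also have "\<dots> \<le> card F ^ (Suc (M * c + C) * d)" by (rule card_L)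
      finally have "card F ^ (Suc n * Suc M) \<le> card F ^ (Suc (M * c + C) * d)"
        by (simp add: S_def card_PiE card_cartesian_product)
      then have "Suc n * Suc M \<le> Suc (M * c + C) * d"
        using power_increasing_iff[OF card_F] by blast
      also have "\<dots> = n * M + M" by (simp add: n_def M_def algebra_simps)
      finally show False by simp
    qed
    then obtain a a' where a: "a \<in> S" "a' \<in> S" "a \<noteq> a'" "D * \<phi> a = D * \<phi> a'"
      by (auto simp: inj_on_def)
    then have eq: "\<phi> a = \<phi> a'" using D0 by simp
    obtain i0 k0 where neq: "i0 \<le> n" "k0 \<le> M" "a (i0, k0) \<noteq> a' (i0, k0)"
    proof -
      obtain ik where "ik \<in> {..n} \<times> {..M}" "a ik \<noteq> a' ik"
        using a(1-3) PiE_ext[of a "{..n} \<times> {..M}" "\<lambda>_. F" a'] unfolding S_def by blast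
      then show thesis using that by (cases ik) auto
    qed
    have inF: "a (i, k) - a' (i, k) \<in> F" if "i \<le> n" "k \<le> M" for i k
      using PiE_mem[OF a(1)[unfolded S_def], of "(i,k)"] PiE_mem[OF a(2)[unfolded S_def], of "(i,k)"] that
      by (auto intro: F_closed)
    define f where "f i = (if i \<le> n then \<Sum>k\<le>M. monom (a (i,k) - a' (i,k)) k else 0)" for i
    have "coeff (f i0) k0 = a (i0, k0) - a' (i0, k0)"
      using neq by (simp add: f_def coeff_sum)
    then have "f i0 \<noteq> 0" using neq by auto
    moreover have "f i \<in> polys_over F" for i
      by (auto simp: f_def intro!: PF_closed inF)
    moreover have "(\<Sum>i\<le>n. poly (f i) y * z i) = \<phi> a - \<phi> a'"
      unfolding \<phi>_def sum.cartesian_product[symmetric] sum_subtractf[symmetric]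
      by (rule sum.cong) (auto simp: f_def poly_sum poly_monom sum_distrib_right sum_distrib_left sum_subtractf[symmetric] algebra_simps)
    ultimately show ?thesis using eq neq(1) by (intro exI[of _ f]) auto
  qed
  then show ?thesis by blast
qed

text \<open>Dividing out common powers of \<open>y\<close> makes the relation nontrivial modulo \<open>y\<close>.\<close>

lemma dependent_over_polys_primitive:
  assumes "y \<noteq> 0"
  shows "\<exists>n. \<forall>z :: nat \<Rightarrow> 'k. \<exists>f. (\<forall>i. f i \<in> polys_over F) \<and> (\<exists>i\<le>n. coeff (f i) 0 \<noteq> 0) \<and>
     (\<Sum>i\<le>n. poly (f i) y * z i) = 0"
proof -
  obtain n where n: "\<And>z :: nat \<Rightarrow> 'k. \<exists>f. (\<forall>i. f i \<in> polys_over F) \<and> (\<exists>i\<le>n. f i \<noteq> 0) \<and>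
     (\<Sum>i\<le>n. poly (f i) y * z i) = 0"
    using dependent_over_polys[of y] by blast
  show ?thesis
  proof (rule exI[of _ n], rule allI)
    fix z :: "nat \<Rightarrow> 'k"
    obtain f i0 where f: "\<And>i. f i \<in> polys_over F" "i0 \<le> n" "f i0 \<noteq> 0" "(\<Sum>i\<le>n. poly (f i) y * z i) = 0"
      using n by blast
    define Q where "Q k \<longleftrightarrow> (\<exists>i\<le>n. coeff (f i) k \<noteq> 0)" for k
    have "Q (degree (f i0))" unfolding Q_def using f(2,3) by (auto intro!: exI[of _ i0])
    define k where "k = (LEAST k. Q k)"
    have k: "Q k" unfolding k_def by (rule LeastI) fact
    have low: "coeff (f i) j = 0" if "i \<le> n" "j < k" for i j
      using not_less_Least[of j Q] that by (auto simp: k_def Q_def)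
    have split: "f i = monom 1 k * poly_shift k (f i)" if "i \<le> n" for i
      using low[OF that] by (auto simp: poly_eq_iff coeff_monom_mult coeff_poly_shift)
    have "y ^ k * (\<Sum>i\<le>n. poly (poly_shift k (f i)) y * z i) = (\<Sum>i\<le>n. poly (f i) y * z i)"
      unfolding sum_distrib_left
    proof (rule sum.cong)
      fix i assume "i \<in> {..n}"
      then have "poly (f i) y = poly (monom 1 k * poly_shift k (f i)) y" using split by simp
      then show "y ^ k * (poly (poly_shift k (f i)) y * z i) = poly (f i) y * z i"
        by (simp add: poly_monom mult.assoc)
    qed simp
    then have "(\<Sum>i\<le>n. poly (poly_shift k (f i)) y * z i) = 0" using f(4) assms by simp
    moreover have "\<exists>i\<le>n. coeff (poly_shift k (f i)) 0 \<noteq> 0"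
      using k by (simp add: Q_def coeff_poly_shift)
    ultimately show "\<exists>f. (\<forall>i. f i \<in> polys_over F) \<and> (\<exists>i\<le>n. coeff (f i) 0 \<noteq> 0) \<and>
       (\<Sum>i\<le>n. poly (f i) y * z i) = 0"
      using f(1) by (intro exI[of _ "\<lambda>i. poly_shift k (f i)"]) (auto intro: PF_closed)
  qed
qed

end

section \<open>Valuation rings\<close>

lemma poly_split_monom:
  assumes "p \<in> polys_over A" "p \<noteq> 0" "ring_set A"
  obtains k q where "q \<in> polys_over A" "p = monom 1 k * q" "coeff q 0 \<noteq> 0"
proof -
  define k where "k = (LEAST k. coeff p k \<noteq> 0)"
  have "coeff p (degree p) \<noteq> 0" using assms(2) by simp
  then have k: "coeff p k \<noteq> 0" unfolding k_def by (rule LeastI)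
  have low: "coeff p j = 0" if "j < k" for j
    using not_less_Least[of j "\<lambda>k. coeff p k \<noteq> 0"] that by (auto simp: k_def)
  show thesis
  proof (rule that)
    show "poly_shift k p \<in> polys_over A" using assms by (auto intro: polys_over_closed)
    show "p = monom 1 k * poly_shift k p"
      using low by (auto simp: poly_eq_iff coeff_monom_mult coeff_poly_shift)
    show "coeff (poly_shift k p) 0 \<noteq> 0" using k by (simp add: coeff_poly_shift)
  qed
qed

context finite_constants
begin

definition valring :: "'k set \<Rightarrow> bool" where
  "valring V \<longleftrightarrow> ring_set V \<and> F \<subseteq> V \<and> (\<forall>z. z \<in> V \<or> inverse z \<in> V)"

context
  fixes V assumes V: "valring V"
begin

lemma ring_V: "ring_set V"
  using V by (simp add: valring_def)

lemmas V_closed = ring_set_closed[OF ring_V] ring_set_sum[OF ring_V] ring_set_power[OF ring_V]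

lemma F_in_V: "a \<in> F \<Longrightarrow> a \<in> V"
  using V by (auto simp: valring_def)

lemma polys_over_V: "p \<in> polys_over F \<Longrightarrow> p \<in> polys_over V"
  using F_in_V by (auto simp: polys_over_def)

lemma poly_in_V: "p \<in> polys_over F \<Longrightarrow> y \<in> V \<Longrightarrow> poly p y \<in> V"
  using poly_in_ring_set[OF ring_V] polys_over_V by blast

lemma nonunits_iff: "x \<in> nonunits V \<longleftrightarrow> x \<in> V \<and> (x = 0 \<or> inverse x \<notin> V)"
proof -
  have "(\<exists>y\<in>V. x * y = 1) \<longleftrightarrow> x \<noteq> 0 \<and> inverse x \<in> V"
    by (metis inverse_unique mult_zero_left right_inverse zero_neq_one)
  then show ?thesis unfolding nonunits_def by blast
qed

lemma inverse_in_nonunits: "x \<notin> V \<Longrightarrow> x \<noteq> 0 \<and> inverse x \<in> nonunits V"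
  using V by (auto simp: nonunits_iff valring_def V_closed)

lemma nonunits_subset: "x \<in> nonunits V \<Longrightarrow> x \<in> V"
  by (simp add: nonunits_iff)

lemma nonunits_0: "0 \<in> nonunits V"
  by (simp add: nonunits_iff V_closed)

lemma nonunits_1: "1 \<notin> nonunits V"
  by (simp add: nonunits_iff V_closed)

lemma nonunits_mult: "v \<in> V \<Longrightarrow> x \<in> nonunits V \<Longrightarrow> v * x \<in> nonunits V"
proof -
  assume v: "v \<in> V" and x: "x \<in> nonunits V"
  have "inverse x \<in> V" if "v * x \<noteq> 0" "inverse (v * x) \<in> V"
  proof -
    have "v * inverse (v * x) = inverse x" using that by (simp add: field_simps)
    then show ?thesis using V_closed(6)[OF v that(2)] by (simp only:)
  qed
  with v x show ?thesis by (auto simp: nonunits_iff V_closed)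
qed

text \<open>One of \<open>x / y\<close> and \<open>y / x\<close> lies in \<open>V\<close>. In the
  first case \<open>x + y = (x / y + 1) * y\<close> is a multiple of a nonunit; the second is
  symmetric.\<close>

lemma nonunits_add:
  assumes x: "x \<in> nonunits V" and y: "y \<in> nonunits V"
  shows "x + y \<in> nonunits V"
proof -
  have *: "u + w \<in> nonunits V" if u: "u \<in> nonunits V" and w: "w \<in> nonunits V"
    and uw: "u * inverse w \<in> V" "w \<noteq> 0" for u w
  proof -
    have "u + w = (u * inverse w + 1) * w" using uw(2) by (simp add: field_simps)
    also have "\<dots> \<in> nonunits V"
      by (intro nonunits_mult w V_closed uw(1))
    finally show ?thesis .
  qed
  show ?thesis
  proof (cases "x = 0 \<or> y = 0")
    case True
    then show ?thesis using x y by auto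
  next
    case False
    have "x * inverse y \<in> V \<or> inverse (x * inverse y) \<in> V"
      using V unfolding valring_def by blast
    then have "x * inverse y \<in> V \<or> y * inverse x \<in> V"
      by (simp add: mult.commute)
    then show ?thesis using *[OF x y] *[OF y x] False by (auto simp: add.commute)
  qed
qed

lemma nonunits_uminus: "x \<in> nonunits V \<Longrightarrow> - x \<in> nonunits V"
  using nonunits_mult[of "-1" x] by (simp add: V_closed)

lemma nonunits_diff: "x \<in> nonunits V \<Longrightarrow> y \<in> nonunits V \<Longrightarrow> x - y \<in> nonunits V"
  using nonunits_add[of x "- y"] nonunits_uminus by simp

lemma nonunits_sum: "(\<And>i. i \<in> I \<Longrightarrow> f i \<in> nonunits V) \<Longrightarrow> sum f I \<in> nonunits V"
  by (induction I rule: infinite_finite_induct) (auto intro: nonunits_add nonunits_0)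

lemma unitD: "x \<in> V \<Longrightarrow> x \<notin> nonunits V \<Longrightarrow> x \<noteq> 0 \<and> inverse x \<in> V \<and> inverse x \<notin> nonunits V"
  by (auto simp: nonunits_iff)

lemma unit_mult: "x \<in> V \<Longrightarrow> x \<notin> nonunits V \<Longrightarrow> y \<notin> nonunits V \<Longrightarrow> x * y \<notin> nonunits V"
proof
  assume x: "x \<in> V" "x \<notin> nonunits V" and y: "y \<notin> nonunits V" and xy: "x * y \<in> nonunits V"
  have "inverse x * (x * y) \<in> nonunits V"
    using unitD[OF x] by (intro nonunits_mult xy) auto
  also have "inverse x * (x * y) = y" using unitD[OF x] by simp
  finally show False using y by simp
qed

lemma unit_prod:
  "(\<And>i. i \<in> I \<Longrightarrow> f i \<in> V \<and> f i \<notin> nonunits V) \<Longrightarrow> prod f I \<in> V \<and> prod f I \<notin> nonunits V"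
  by (induction I rule: infinite_finite_induct) (simp_all add: V_closed nonunits_1 unit_mult)

lemma unit_power: "x \<in> V \<Longrightarrow> x \<notin> nonunits V \<Longrightarrow> x ^ n \<notin> nonunits V"
  using unit_prod[of "{..<n}" "\<lambda>_. x"] by simp

lemma unit_add: "x \<notin> nonunits V \<Longrightarrow> y \<in> nonunits V \<Longrightarrow> x + y \<notin> nonunits V"
  using nonunits_diff[of "x + y" y] by auto

lemma constant_unit: "a \<in> F \<Longrightarrow> a \<noteq> 0 \<Longrightarrow> a \<notin> nonunits V"
  using inverse_F F_in_V by (auto simp: nonunits_iff)

text \<open>The difference is a multiple of \<open>s\<close>: modulo the maximal ideal, only the
  constant term of \<open>p\<close> survives.\<close>

lemma poly_mod_nonunits:
  assumes "p \<in> polys_over F" "s \<in> nonunits V"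
  shows "poly p s - coeff p 0 \<in> nonunits V"
proof -
  obtain a q where p: "p = pCons a q" by (cases p)
  have q: "q \<in> polys_over F"
    using assms(1) by (auto simp: p polys_over_def coeff_pCons split: nat.splits dest: spec[of _ "Suc _"])
  have "poly q s * s \<in> nonunits V"
    using assms(2) by (intro nonunits_mult poly_in_V q) (simp_all add: nonunits_iff)
  then show ?thesis by (simp add: p mult.commute)
qed

lemma poly_unit:
  assumes "p \<in> polys_over F" "s \<in> nonunits V" "coeff p 0 \<noteq> 0"
  shows "poly p s \<in> V" "poly p s \<notin> nonunits V"
proof -
  show "poly p s \<in> V" using assms by (intro poly_in_V) (simp_all add: nonunits_iff)
  have "coeff p 0 \<in> F" using assms(1) by (simp add: polys_over_def)
  then have "coeff p 0 + (poly p s - coeff p 0) \<notin> nonunits V"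
    by (intro unit_add constant_unit poly_mod_nonunits assms)
  then show "poly p s \<notin> nonunits V" by simp
qed

text \<open>This is integral closedness of valuation rings, for equations that need not be monic. If
  \<open>w\<close> is not in \<open>V\<close>, then \<open>inverse w\<close> is, and dividing the
  equation by \<open>w ^ (n - 1)\<close> writes the product as a polynomial in
  \<open>inverse w\<close>.\<close>

lemma lead_coeff_mult_root:
  assumes p: "p \<in> polys_over V" "p \<noteq> 0" and root: "poly p w = 0"
  shows "lead_coeff p * w \<in> V"
proof (cases "w \<in> V")
  case True
  then show ?thesis using p(1) by (auto simp: polys_over_def intro: V_closed)
next
  case False
  then have w: "w \<noteq> 0" "inverse w \<in> V" using V by (auto simp: valring_def V_closed)
  define n where "n = degree p"
  have "n \<noteq> 0"
  proof
    assume "n = 0"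
    then obtain a where "p = [:a:]" unfolding n_def by (rule degree_eq_zeroE)
    then show False using p(2) root by simp
  qed
  then obtain m where m: "n = Suc m" by (cases n) auto
  have "(\<Sum>i\<le>n. coeff p i * w ^ i) = 0"
    using root by (simp add: poly_altdef n_def)
  then have "lead_coeff p * w ^ n = - (\<Sum>i<n. coeff p i * w ^ i)"
    by (simp add: n_def[symmetric] lessThan_Suc_atMost[symmetric] eq_neg_iff_add_eq_0 add.commute)
  then have "inverse w ^ m * (lead_coeff p * w ^ n) = - (\<Sum>i<n. coeff p i * (w ^ i * inverse w ^ m))"
    by (simp add: sum_distrib_left mult_ac)
  moreover have "inverse w ^ m * (lead_coeff p * w ^ n) = lead_coeff p * w"
    using w by (simp add: m field_simps)
  moreover have "w ^ i * inverse w ^ m = inverse w ^ (m - i)" if "i < n" for i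
    using that w m by (simp add: power_diff field_simps)
  ultimately have "lead_coeff p * w = - (\<Sum>i<n. coeff p i * inverse w ^ (m - i))"
    by simp
  also have "\<dots> \<in> V"
    using p(1) w(2) by (auto simp: polys_over_def intro!: V_closed)
  finally show ?thesis .
qed

text \<open>Otherwise \<open>w\<close> would be a root of \<open>p - poly p w\<close>, whose leading
  coefficient is a nonzero constant and hence a unit, so that \<open>w\<close> would lie in
  \<open>V\<close>.\<close>

lemma poly_notin_V:
  assumes "w \<notin> V" "p \<in> polys_over F" "degree p > 0"
  shows "poly p w \<notin> V"
proof
  assume v: "poly p w \<in> V"
  define q where "q = p + [:- poly p w:]"
  have "degree q = degree p"
    using assms(3) unfolding q_def by (simp add: degree_add_eq_left)
  then have lc: "lead_coeff q = lead_coeff p" "q \<noteq> 0"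
    using assms(3) by (auto simp: q_def coeff_pCons split: nat.splits)
  have "q \<in> polys_over V"
    unfolding q_def using v
    by (intro polys_over_closed[OF ring_V] polys_over_V assms(2) V_closed)
  moreover have "poly q w = 0" by (simp add: q_def)
  ultimately have "lead_coeff q * w \<in> V"
    using lead_coeff_mult_root[of q w] lc(2) by blast
  moreover have "lead_coeff p \<in> F" "lead_coeff p \<noteq> 0"
    using assms(2,3) by (auto simp: polys_over_def)
  ultimately have "inverse (lead_coeff p) * (lead_coeff p * w) \<in> V"
    unfolding lc using V_closed(6)[OF F_in_V[OF inverse_F]] by blast
  also have "inverse (lead_coeff p) * (lead_coeff p * w) = w"
    using \<open>lead_coeff p \<noteq> 0\<close> by (simp flip: mult.assoc)
  finally show False using assms(1) by simp
qed

text \<open>This supplies the transcendence over \<open>F\<close> of every element that has a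
  pole.\<close>

lemma poly_neq_0_if_notin_V:
  assumes "w \<notin> V" "p \<in> polys_over F" "p \<noteq> 0"
  shows "poly p w \<noteq> 0"
proof (cases "degree p = 0")
  case True
  then obtain a where "p = [:a:]" by (rule degree_eq_zeroE)
  then show ?thesis using assms(3) by auto
next
  case False
  then show ?thesis using poly_notin_V[OF assms(1,2)] V_closed(1) by auto
qed

end

end

section \<open>Valuation rings at which a given element vanishes\<close>

context function_field
begin

text \<open>One polynomial relation for \<open>w\<close> works simultaneously in the residue fields of all valuation
  rings at which \<open>s\<close> vanishes.\<close>

lemma residue_algebraic:
  assumes "s \<noteq> 0"
  obtains Q where "Q \<in> polys_over F" "Q \<noteq> 0"
    "\<And>W. valring W \<Longrightarrow> s \<in> nonunits W \<Longrightarrow> w \<in> W \<Longrightarrow> poly Q w \<in> nonunits W"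
proof -
  obtain n where n: "\<forall>z :: nat \<Rightarrow> 'k. \<exists>f. (\<forall>i. f i \<in> polys_over F) \<and> (\<exists>i\<le>n. coeff (f i) 0 \<noteq> 0) \<and>
     (\<Sum>i\<le>n. poly (f i) s * z i) = 0"
    using dependent_over_polys_primitive[OF assms] by blast
  obtain f i0 where f: "\<And>i. f i \<in> polys_over F" "i0 \<le> n" "coeff (f i0) 0 \<noteq> 0"
    "(\<Sum>i\<le>n. poly (f i) s * w ^ i) = 0"
    using spec[OF n, of "\<lambda>i. w ^ i"] by blast
  \<comment> \<open>\<open>Q\<close> is the relation reduced modulo \<open>s\<close>; primitivity
    keeps it nonzero.\<close>
  define Q where "Q = (\<Sum>i\<le>n. monom (coeff (f i) 0) i)"
  show thesis
  proof (rule that)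
    have "coeff Q i0 \<noteq> 0" using f by (simp add: Q_def coeff_sum)
    then show "Q \<noteq> 0" by auto
    show "Q \<in> polys_over F"
      unfolding Q_def using f(1) by (intro PF_closed) (simp add: polys_over_def)
    fix W assume W: "valring W" "s \<in> nonunits W" "w \<in> W"
    have "(\<Sum>i\<le>n. w ^ i * (poly (f i) s - coeff (f i) 0)) \<in> nonunits W"
      using W f(1) by (intro nonunits_sum nonunits_mult poly_mod_nonunits V_closed[OF W(1)])
    also have "(\<Sum>i\<le>n. w ^ i * (poly (f i) s - coeff (f i) 0)) = - poly Q w"
      using f(4) by (simp add: Q_def poly_sum poly_monom algebra_simps sum_subtractf)
    finally show "poly Q w \<in> nonunits W" using nonunits_uminus[OF W(1)] by fastforce
  qed
qed

text \<open>For \<open>w\<close> in \<open>W\<close> but not in \<open>V\<close>, the inverse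
  \<open>y\<close> is a unit of \<open>W\<close> and a nonunit of \<open>V\<close>. It is algebraic
  in the residue field of \<open>W\<close>, so after cancelling powers of \<open>y\<close> some
  \<open>poly q y\<close> with \<open>coeff q 0 \<noteq> 0\<close> is a nonunit of \<open>W\<close>.
  But it is a unit of \<open>V\<close>, hence of \<open>W\<close>.\<close>

lemma valring_incomparable:
  assumes s: "s \<noteq> 0" and V: "valring V" "s \<in> nonunits V" and W: "valring W" "s \<in> nonunits W"
    and sub: "V \<subseteq> W"
  shows "V = W"
proof (rule ccontr)
  assume "V \<noteq> W"
  then obtain w where w: "w \<in> W" "w \<notin> V" using sub by blast
  define y where "y = inverse w"
  have y: "w \<noteq> 0" "y \<in> nonunits V" using inverse_in_nonunits[OF V(1) w(2)] by (auto simp: y_def)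
  then have "y \<in> W" using sub nonunits_subset[OF V(1)] by auto
  obtain Q where Q: "Q \<in> polys_over F" "Q \<noteq> 0" "poly Q y \<in> nonunits W"
    using residue_algebraic[OF s, of y] W \<open>y \<in> W\<close> by metis
  obtain k q where q: "q \<in> polys_over F" "Q = monom 1 k * q" "coeff q 0 \<noteq> 0"
    using poly_split_monom[OF Q(1,2) ring_F] .
  have "w ^ k * poly Q y \<in> nonunits W"
    by (intro nonunits_mult W Q V_closed[OF W(1)] w)
  also have "w ^ k * poly Q y = poly q y"
    using y(1) by (simp add: q(2) poly_monom y_def field_simps)
  finally have qy: "poly q y \<in> nonunits W" .
  have "poly q y \<in> V" "poly q y \<notin> nonunits V"
    using poly_unit[OF V(1) q(1) y(2) q(3)] by auto
  then have "poly q y \<noteq> 0" "inverse (poly q y) \<in> W"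
    using unitD[OF V(1)] sub by blast+
  then show False using qy by (simp add: nonunits_iff[OF W(1)])
qed

text \<open>Take \<open>y\<close> in \<open>V\<close> but not in \<open>W\<close>, and
  \<open>Q\<close> annihilating the residue of \<open>y\<close> wherever \<open>y\<close> is
  regular. Then \<open>1 + y * poly Q y\<close> reduces to 1 where \<open>y\<close> is regular and
  has a pole where \<open>y\<close> has one; its inverse is the required element.\<close>

lemma separating_element:
  assumes s: "s \<noteq> 0" and V: "valring V" "s \<in> nonunits V" and W: "valring W" "s \<in> nonunits W"
    and "V \<noteq> W"
  obtains u where "u \<in> nonunits W" "u \<notin> nonunits V"
    "\<And>U. valring U \<Longrightarrow> s \<in> nonunits U \<Longrightarrow> u \<in> U"
proof -
  obtain y where y: "y \<in> V" "y \<notin> W"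
    using valring_incomparable[OF s V W] assms(6) by blast
  obtain Q where Q: "Q \<in> polys_over F" "Q \<noteq> 0"
    "\<And>W. valring W \<Longrightarrow> s \<in> nonunits W \<Longrightarrow> y \<in> W \<Longrightarrow> poly Q y \<in> nonunits W"
    using residue_algebraic[OF s, of y] by metis
  define p where "p = pCons 1 Q"
  have p: "p \<in> polys_over F" "degree p > 0"
    using Q by (auto simp: p_def intro: PF_closed F_closed)
  have unit: "poly p y \<in> U \<and> poly p y \<notin> nonunits U"
    if U: "valring U" "s \<in> nonunits U" "y \<in> U" for U
  proof -
    have "y * poly Q y \<in> nonunits U" by (intro nonunits_mult U Q)
    then have "1 + y * poly Q y \<notin> nonunits U"
      by (intro unit_add U nonunits_1)
    moreover have "poly p y \<in> U" by (intro poly_in_V U p)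
    ultimately show ?thesis by (simp add: p_def)
  qed
  have pole: "inverse (poly p y) \<in> nonunits U" if U: "valring U" "y \<notin> U" for U
    using inverse_in_nonunits[OF U(1) poly_notin_V[OF U(1,2) p]] by simp
  show thesis
  proof (rule that)
    show "inverse (poly p y) \<in> nonunits W" by (rule pole[OF W(1) y(2)])
    show "inverse (poly p y) \<notin> nonunits V" using unitD[OF V(1)] unit[OF V y(1)] by blast
    fix U assume U: "valring U" "s \<in> nonunits U"
    show "inverse (poly p y) \<in> U"
      using unitD[OF U(1)] unit[OF U] pole[OF U(1)] nonunits_subset[OF U(1)] by blast
  qed
qed

text \<open>The product of the separating elements for the members of \<open>T\<close> works: all
  factors are units at \<open>V\<close>, and each \<open>W\<close> in \<open>T\<close> has a factor
  vanishing there.\<close>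

lemma separating_element_finite:
  assumes s: "s \<noteq> 0" and V: "valring V" "s \<in> nonunits V"
    and T: "finite T" "\<And>W. W \<in> T \<Longrightarrow> valring W \<and> s \<in> nonunits W \<and> W \<noteq> V"
  obtains u where "u \<notin> nonunits V" "\<And>W. W \<in> T \<Longrightarrow> u \<in> nonunits W"
    "\<And>U. valring U \<Longrightarrow> s \<in> nonunits U \<Longrightarrow> u \<in> U"
proof -
  have "\<exists>u. u \<in> nonunits W \<and> u \<notin> nonunits V \<and> (\<forall>U. valring U \<and> s \<in> nonunits U \<longrightarrow> u \<in> U)"
    if "W \<in> T" for W
    using separating_element[OF s V, of W] T(2)[OF that] by metis
  then obtain u where u: "\<And>W. W \<in> T \<Longrightarrow> u W \<in> nonunits W \<and> u W \<notin> nonunits V"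
    "\<And>W U. W \<in> T \<Longrightarrow> valring U \<Longrightarrow> s \<in> nonunits U \<Longrightarrow> u W \<in> U"
    by metis
  have in_U: "prod u T' \<in> U" if "valring U" "s \<in> nonunits U" "T' \<subseteq> T" for U T'
    using finite_subset[OF that(3) T(1)] that(3)
    by (induction rule: finite_induct) (use that in \<open>auto intro!: V_closed[OF that(1)] u\<close>)
  show thesis
  proof (rule that)
    show "prod u T \<notin> nonunits V"
      using unit_prod[OF V(1), of T u] u V by blast
    show "prod u T \<in> U" if "valring U" "s \<in> nonunits U" for U
      using in_U[OF that] by simp
    fix W assume W: "W \<in> T"
    have "prod u (T - {W}) * u W \<in> nonunits W"
      by (intro nonunits_mult in_U) (use T W u in auto)
    then show "prod u T \<in> nonunits W"
      using T(1) W by (simp add: prod.remove mult.commute)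
  qed
qed

text \<open>There are at most \<open>[K : F(s)]\<close> such valuation rings, because separating elements
  for them are linearly independent over \<open>F(s)\<close>.\<close>

lemma finite_valrings_above:
  assumes s: "s \<noteq> 0"
  shows "finite {W. valring W \<and> s \<in> nonunits W}" (is "finite ?S")
proof (rule ccontr)
  assume inf: "infinite ?S"
  obtain n where n: "\<forall>z :: nat \<Rightarrow> 'k. \<exists>f. (\<forall>i. f i \<in> polys_over F) \<and> (\<exists>i\<le>n. coeff (f i) 0 \<noteq> 0) \<and>
     (\<Sum>i\<le>n. poly (f i) s * z i) = 0"
    using dependent_over_polys_primitive[OF s] by blast
  obtain g :: "nat \<Rightarrow> 'k set" where g: "inj g" "range g \<subseteq> ?S"
    using infinite_countable_subset[OF inf] by blast
  have gS: "valring (g i)" "s \<in> nonunits (g i)" for i using g(2) by auto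
  \<comment> \<open>In the residue fields of \<open>g 0\<close>, ..., \<open>g n\<close> these
    elements behave like a Kronecker delta.\<close>
  have "\<exists>u. u \<notin> nonunits (g i) \<and> (\<forall>j\<in>{..n} - {i}. u \<in> nonunits (g j)) \<and> (\<forall>j. u \<in> g j)" for i
  proof -
    have fin: "finite (g ` ({..n} - {i}))" by simp
    have T: "valring W \<and> s \<in> nonunits W \<and> W \<noteq> g i" if "W \<in> g ` ({..n} - {i})" for W
      using that gS g(1) by (auto simp: inj_def)
    obtain u where "u \<notin> nonunits (g i)" "\<And>W. W \<in> g ` ({..n} - {i}) \<Longrightarrow> u \<in> nonunits W"
      "\<And>U. valring U \<Longrightarrow> s \<in> nonunits U \<Longrightarrow> u \<in> U"
      using separating_element_finite[OF s gS(1,2)[of i] fin T] by blast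
    then show ?thesis using gS by (intro exI[of _ u]) auto
  qed
  then obtain e where e: "\<And>i. e i \<notin> nonunits (g i)"
    "\<And>i j. j \<le> n \<Longrightarrow> j \<noteq> i \<Longrightarrow> e i \<in> nonunits (g j)"
    by (metis DiffI atMost_iff singletonD)
  obtain f i0 where f: "\<And>i. f i \<in> polys_over F" "i0 \<le> n" "coeff (f i0) 0 \<noteq> 0"
    "(\<Sum>i\<le>n. poly (f i) s * e i) = 0"
    using spec[OF n, of e] by blast
  note W = gS[of i0]
  \<comment> \<open>Modulo the maximal ideal of \<open>g i0\<close> only the term with index
    \<open>i0\<close> survives, and it is a unit.\<close>
  have "(\<Sum>i\<in>{..n} - {i0}. poly (f i) s * e i) \<in> nonunits (g i0)"
    by (rule nonunits_sum[OF W(1)], rule nonunits_mult[OF W(1)], rule poly_in_V[OF W(1)])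
      (use f(1,2) e(2) nonunits_subset[OF W(1) W(2)] in auto)
  moreover have "poly (f i0) s * e i0 = - (\<Sum>i\<in>{..n} - {i0}. poly (f i) s * e i)"
    using f(2,4) sum.remove[of "{..n}" i0 "\<lambda>i. poly (f i) s * e i"] by (simp add: eq_neg_iff_add_eq_0)
  ultimately have "poly (f i0) s * e i0 \<in> nonunits (g i0)"
    using nonunits_uminus[OF W(1)] by simp
  moreover have "poly (f i0) s * e i0 \<notin> nonunits (g i0)"
    by (rule unit_mult[OF W(1) poly_unit[OF W(1) f(1) W(2) f(3)] e(1)])
  ultimately show False by simp
qed

text \<open>This stands in for discreteness of the valuations. In a relation between the powers of
  \<open>u\<close>, let \<open>k\<close> be the first index with
  \<open>coeff (f k) 0 \<noteq> 0\<close>. The terms before \<open>k\<close> are divisible by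
  \<open>s\<close>, the others add up to \<open>u ^ k\<close> times a unit \<open>E\<close>; so
  \<open>s\<close> divides \<open>u ^ k\<close>, in all the rings at once.\<close>

lemma power_divisible:
  assumes s: "s \<noteq> 0"
  obtains n where "\<And>W. valring W \<Longrightarrow> s \<in> nonunits W \<Longrightarrow> u \<in> nonunits W \<Longrightarrow> u ^ n * inverse s \<in> W"
proof -
  obtain n where n: "\<forall>z :: nat \<Rightarrow> 'k. \<exists>f. (\<forall>i. f i \<in> polys_over F) \<and> (\<exists>i\<le>n. coeff (f i) 0 \<noteq> 0) \<and>
     (\<Sum>i\<le>n. poly (f i) s * z i) = 0"
    using dependent_over_polys_primitive[OF s] by blast
  obtain f i0 where f: "\<And>i. f i \<in> polys_over F" "i0 \<le> n" "coeff (f i0) 0 \<noteq> 0"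
    "(\<Sum>i\<le>n. poly (f i) s * u ^ i) = 0"
    using spec[OF n, of "\<lambda>i. u ^ i"] by blast
  define k where "k = (LEAST i. coeff (f i) 0 \<noteq> 0)"
  have k: "coeff (f k) 0 \<noteq> 0" unfolding k_def by (rule LeastI[of _ i0]) (fact f(3))
  have kn: "k \<le> n" using Least_le[of "\<lambda>i. coeff (f i) 0 \<noteq> 0" i0] f(2,3) by (simp add: k_def)
  have low: "poly (f j) s = s * poly (poly_shift 1 (f j)) s" if "j < k" for j
  proof -
    have "coeff (f j) 0 = 0" using not_less_Least[of j "\<lambda>i. coeff (f i) 0 \<noteq> 0"] that by (simp add: k_def)
    then have "f j = pCons 0 (poly_shift 1 (f j))"
      by (auto simp: poly_eq_iff coeff_pCons coeff_poly_shift split: nat.splits)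
    then have "poly (f j) s = poly (pCons 0 (poly_shift 1 (f j))) s" by simp
    then show ?thesis by simp
  qed
  define E where "E = poly (f k) s + (\<Sum>j\<in>{k<..n}. poly (f j) s * u ^ (j - k))"
  define R where "R = (\<Sum>j<k. poly (poly_shift 1 (f j)) s * u ^ j)"
  have "{..n} = {..<k} \<union> ({k} \<union> {k<..n})" using kn by auto
  then have "(\<Sum>i\<le>n. poly (f i) s * u ^ i) =
      (\<Sum>i<k. poly (f i) s * u ^ i) + (poly (f k) s * u ^ k + (\<Sum>i\<in>{k<..n}. poly (f i) s * u ^ i))"
    by (simp only:) (subst sum.union_disjoint; force)
  moreover have "(\<Sum>i<k. poly (f i) s * u ^ i) = s * R"
    by (simp add: R_def sum_distrib_left low mult.assoc)
  moreover have "u ^ j = u ^ k * u ^ (j - k)" if "j \<in> {k<..n}" for j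
    using that by (simp flip: power_add)
  then have "poly (f k) s * u ^ k + (\<Sum>i\<in>{k<..n}. poly (f i) s * u ^ i) = u ^ k * E"
    by (simp add: E_def sum_distrib_left algebra_simps)
  ultimately have rel: "u ^ k * E = - (s * R)"
    using f(4) by (simp add: eq_neg_iff_add_eq_0 add.commute)
  show thesis
  proof (rule that)
    fix W assume W: "valring W" "s \<in> nonunits W" "u \<in> nonunits W"
    note sub = nonunits_subset[OF W(1)]
    have "(\<Sum>j\<in>{k<..n}. (poly (f j) s * u ^ (j - k - 1)) * u) \<in> nonunits W"
      using f(1) sub[OF W(2)] sub[OF W(3)]
      by (intro nonunits_sum nonunits_mult V_closed[OF W(1)] poly_in_V W)
    also have "(\<Sum>j\<in>{k<..n}. (poly (f j) s * u ^ (j - k - 1)) * u) = (\<Sum>j\<in>{k<..n}. poly (f j) s * u ^ (j - k))"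
    proof (rule sum.cong)
      fix j assume "j \<in> {k<..n}"
      then have "j - k = Suc (j - k - 1)" by auto
      then show "(poly (f j) s * u ^ (j - k - 1)) * u = poly (f j) s * u ^ (j - k)"
        by (metis mult.assoc power_Suc2)
    qed simp
    finally have "E \<notin> nonunits W"
      unfolding E_def by (rule unit_add[OF W(1) poly_unit(2)[OF W(1) f(1) W(2) k]])
    moreover have "E \<in> W"
      unfolding E_def using f(1) sub[OF W(2)] sub[OF W(3)]
      by (intro V_closed[OF W(1)] poly_in_V[OF W(1)])
    ultimately have E: "E \<noteq> 0" "inverse E \<in> W" using unitD[OF W(1)] by blast+
    have "R \<in> W"
      unfolding R_def using f(1) sub[OF W(2)] sub[OF W(3)]
      by (intro V_closed[OF W(1)] poly_in_V[OF W(1)] polys_over_closed[OF ring_F])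
    then have "u ^ (n - k) * (- R * inverse E) \<in> W"
      using E sub[OF W(3)] by (intro V_closed[OF W(1)])
    moreover have "u ^ k * inverse s = - R * inverse E"
      using rel s E(1) by (simp add: field_simps)
    moreover have "u ^ n = u ^ (n - k) * u ^ k" using kn by (simp flip: power_add)
    ultimately show "u ^ n * inverse s \<in> W" by (simp add: mult.assoc)
  qed
qed

text \<open>If \<open>u\<close> is a unit at \<open>V\<close> and vanishes at the other zeros of
  \<open>s\<close>, then for large \<open>n\<close> the quotient \<open>u ^ n / s\<close> keeps the
  pole of \<open>1 / s\<close> at \<open>V\<close> only.\<close>

lemma pole_at_one_valring:
  assumes s: "s \<noteq> 0" and V: "valring V" "s \<in> nonunits V"
  obtains z where "z \<notin> V" "\<And>W. valring W \<Longrightarrow> s \<in> nonunits W \<Longrightarrow> W \<noteq> V \<Longrightarrow> z \<in> W"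
proof -
  define T where "T = {W. valring W \<and> s \<in> nonunits W} - {V}"
  have T: "finite T" "\<And>W. W \<in> T \<Longrightarrow> valring W \<and> s \<in> nonunits W \<and> W \<noteq> V"
    using finite_valrings_above[OF s] by (auto simp: T_def)
  obtain u where u: "u \<notin> nonunits V" "\<And>W. W \<in> T \<Longrightarrow> u \<in> nonunits W"
    "\<And>U. valring U \<Longrightarrow> s \<in> nonunits U \<Longrightarrow> u \<in> U"
    using separating_element_finite[OF s V T] by blast
  obtain n where n: "\<And>W. valring W \<Longrightarrow> s \<in> nonunits W \<Longrightarrow> u \<in> nonunits W \<Longrightarrow> u ^ n * inverse s \<in> W"
    using power_divisible[OF s, of u] by blast
  show thesis
  proof (rule that)
    show "u ^ n * inverse s \<notin> V"
    proof
      assume "u ^ n * inverse s \<in> V"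
      then have "u ^ n * inverse s * s \<in> nonunits V" by (intro nonunits_mult V)
      moreover have "u ^ n * inverse s * s = u ^ n" using s by (simp add: field_simps)
      ultimately show False using unit_power[OF V(1) u(3)[OF V] u(1), of n] by simp
    qed
    fix W assume W: "valring W" "s \<in> nonunits W" "W \<noteq> V"
    then show "u ^ n * inverse s \<in> W" by (intro n u(2)) (auto simp: T_def)
  qed
qed

end

section \<open>An element with a single pole\<close>

context finite_constants
begin

definition ratl :: "'k \<Rightarrow> 'k set" where
  "ratl y = {poly f y / poly g y | f g. f \<in> polys_over F \<and> g \<in> polys_over F \<and> poly g y \<noteq> 0}"

lemma ratlI: "f \<in> polys_over F \<Longrightarrow> g \<in> polys_over F \<Longrightarrow> poly g y \<noteq> 0 \<Longrightarrow> poly f y / poly g y \<in> ratl y"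
  by (auto simp: ratl_def)

lemma poly_in_ratl: "f \<in> polys_over F \<Longrightarrow> poly f y \<in> ratl y"
  using ratlI[of f 1 y] by (simp add: PF_closed)

lemma inverse_in_ratl: "r \<in> ratl y \<Longrightarrow> inverse r \<in> ratl y"
proof -
  assume "r \<in> ratl y"
  then obtain f g where fg: "f \<in> polys_over F" "g \<in> polys_over F" "poly g y \<noteq> 0" "r = poly f y / poly g y"
    by (auto simp: ratl_def)
  show ?thesis
  proof (cases "poly f y = 0")
    case True
    then show ?thesis using fg poly_in_ratl[of 0 y] by (simp add: PF_closed)
  next
    case False
    then show ?thesis using fg ratlI[of g f y] by simp
  qed
qed

lemma F_in_ratl: "a \<in> F \<Longrightarrow> a \<in> ratl y"
  using poly_in_ratl[of "[:a:]" y] by (simp add: PF_closed)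

lemma base_in_ratl: "y \<in> ratl y"
  using poly_in_ratl[of "[:0, 1:]" y] by (simp add: PF_closed F_closed)

lemma ring_set_ratl: "ring_set (ratl y)"
  unfolding ring_set_def
proof (intro conjI ballI)
  show "1 \<in> ratl y" by (intro F_in_ratl F_closed)
  fix r r' assume "r \<in> ratl y" "r' \<in> ratl y"
  then obtain f g f' g' where fg: "f \<in> polys_over F" "g \<in> polys_over F" "poly g y \<noteq> 0" "r = poly f y / poly g y"
    "f' \<in> polys_over F" "g' \<in> polys_over F" "poly g' y \<noteq> 0" "r' = poly f' y / poly g' y"
    by (auto simp: ratl_def)
  have "r - r' = poly (f * g' - f' * g) y / poly (g * g') y"
    unfolding fg(4,8) using fg(3,7) by (simp add: field_simps)
  also have "\<dots> \<in> ratl y" using fg(3,7) by (intro ratlI PF_closed fg(1,2,5,6)) simp_all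
  finally show "r - r' \<in> ratl y" .
  have "r * r' = poly (f * f') y / poly (g * g') y"
    unfolding fg(4,8) using fg(3,7) by (simp add: field_simps)
  also have "\<dots> \<in> ratl y" using fg(3,7) by (intro ratlI PF_closed fg(1,2,5,6)) simp_all
  finally show "r * r' \<in> ratl y" .
qed

lemmas ratl_closed = ring_set_closed[OF ring_set_ratl] ring_set_sum[OF ring_set_ratl] ring_set_power[OF ring_set_ratl]

text \<open>\<open>l\<close> is a truncated power series of \<open>f / g\<close> at 0, found one
  coefficient at a time: \<open>a\<close> cancels the constant term of the remainder
  \<open>f'\<close>, which can then be divided by the variable.\<close>

lemma power_series_expansion:
  assumes "f \<in> polys_over F" "g \<in> polys_over F" "coeff g 0 \<noteq> 0"
  shows "\<exists>l f'. l \<in> polys_over F \<and> f' \<in> polys_over F \<and> degree l \<le> N \<and> f = l * g + monom 1 N * f'"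
proof (induction N)
  case 0
  show ?case
    using assms by (intro exI[of _ 0] exI[of _ f]) (simp add: PF_closed)
next
  case (Suc N)
  then obtain l f' where l: "l \<in> polys_over F" "f' \<in> polys_over F" "degree l \<le> N" "f = l * g + monom 1 N * f'"
    by blast
  define a where "a = coeff f' 0 * inverse (coeff g 0)"
  have a: "a \<in> F" using l(2) assms(2) unfolding a_def polys_over_def
    by (auto intro: F_closed inverse_F)
  define h where "h = f' - [:a:] * g"
  have h: "h \<in> polys_over F" "coeff h 0 = 0"
    unfolding h_def by (intro PF_closed l(2) assms(2) a) (simp add: a_def assms(3))
  have "h = monom 1 1 * poly_shift 1 h"
    using h(2) by (auto simp: poly_eq_iff coeff_monom_mult coeff_poly_shift not_less_eq_eq)
  then have "f' = [:a:] * g + monom 1 1 * poly_shift 1 h"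
    by (simp add: h_def algebra_simps)
  then have "f = l * g + monom 1 N * ([:a:] * g + monom 1 1 * poly_shift 1 h)"
    using l(4) by simp
  also have "\<dots> = (l + monom 1 N * [:a:]) * g + (monom 1 N * monom 1 1) * poly_shift 1 h"
    by (simp add: algebra_simps)
  also have "monom 1 N * [:a:] = monom a N"
    by (simp add: smult_monom)
  also have "monom 1 N * monom 1 1 = (monom 1 (Suc N) :: 'k poly)"
    by (simp add: mult_monom)
  finally have "f = (l + monom a N) * g + monom 1 (Suc N) * poly_shift 1 h" .
  moreover have "degree (l + monom a N) \<le> Suc N"
    using l(3) degree_monom_le[of a N] by (intro degree_add_le) auto
  ultimately show ?case
    using l h a by (intro exI[of _ "l + monom a N"] exI[of _ "poly_shift 1 h"]) (auto intro: PF_closed)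
qed

text \<open>Over the finite field \<open>F\<close> there are only finitely many choices for \<open>l\<close>.\<close>

lemma ratl_decomposition:
  assumes s: "s \<noteq> 0" and R: "R \<in> ratl s"
  obtains A l v where "A \<in> polys_over F" "l \<in> polys_over F" "degree l \<le> c"
    "R = poly A (inverse s) + poly l s + s ^ c * v"
    "\<And>W. valring W \<Longrightarrow> s \<in> nonunits W \<Longrightarrow> v \<in> W"
proof -
  obtain f g where fg: "f \<in> polys_over F" "g \<in> polys_over F" "poly g s \<noteq> 0" "R = poly f s / poly g s"
    using R by (auto simp: ratl_def)
  then have "g \<noteq> 0" by auto
  obtain e g' where g': "g' \<in> polys_over F" "g = monom 1 e * g'" "coeff g' 0 \<noteq> 0"
    using poly_split_monom[OF fg(2) \<open>g \<noteq> 0\<close> ring_F] .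
  have g'0: "poly g' s \<noteq> 0" using fg(3) g'(2) by auto
  \<comment> \<open>The order is \<open>e + c\<close> because division by \<open>s ^ e\<close> turns
    the first \<open>e\<close> coefficients into the polar part \<open>A\<close>; a remainder
    divisible by \<open>s ^ c\<close> is left.\<close>
  obtain l f' where l: "l \<in> polys_over F" "f' \<in> polys_over F" "degree l \<le> e + c"
    "f = l * g' + monom 1 (e + c) * f'"
    using power_series_expansion[OF fg(1) g'(1,3), of "e + c"] by blast
  define A where "A = (\<Sum>k<e. monom (coeff l k) (e - k))"
  have "l = (\<Sum>k<e. monom (coeff l k) k) + monom 1 e * poly_shift e l"
    by (auto simp: poly_eq_iff coeff_sum coeff_monom_mult coeff_poly_shift)
  then have "poly l s = poly ((\<Sum>k<e. monom (coeff l k) k) + monom 1 e * poly_shift e l) s"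
    by simp
  also have "\<dots> = (\<Sum>k<e. coeff l k * s ^ k) + s ^ e * poly (poly_shift e l) s"
    by (simp add: poly_sum poly_monom)
  finally have "inverse s ^ e * poly l s = (\<Sum>k<e. coeff l k * (inverse s ^ e * s ^ k)) + poly (poly_shift e l) s"
    using s by (simp add: algebra_simps sum_distrib_left power_inverse)
  also have "(\<Sum>k<e. coeff l k * (inverse s ^ e * s ^ k)) = poly A (inverse s)"
    unfolding A_def poly_sum poly_monom
  proof (rule sum.cong)
    fix k assume "k \<in> {..<e}"
    then have "inverse s ^ e = inverse s ^ (e - k) * inverse s ^ k" by (simp flip: power_add)
    then show "coeff l k * (inverse s ^ e * s ^ k) = coeff l k * inverse s ^ (e - k)"
      using s by (simp add: power_inverse)
  qed simp
  finally have polar: "inverse s ^ e * poly l s = poly A (inverse s) + poly (poly_shift e l) s" .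
  have "R = inverse s ^ e * poly l s + s ^ c * (poly f' s / poly g' s)"
    using s g'0 unfolding fg(4) g'(2) l(4)
    by (simp add: poly_monom field_simps power_add)
  note R = this[unfolded polar]
  show thesis
  proof (rule that)
    show "A \<in> polys_over F" unfolding A_def using l(1) by (intro PF_closed) (auto simp: polys_over_def)
    show "poly_shift e l \<in> polys_over F" using l(1) by (rule PF_closed)
    show "degree (poly_shift e l) \<le> c"
      using l(3) by (intro degree_le) (auto simp: coeff_poly_shift coeff_eq_0)
    show "R = poly A (inverse s) + poly (poly_shift e l) s + s ^ c * (poly f' s / poly g' s)" by (rule R)
    fix W assume W: "valring W" "s \<in> nonunits W"
    have "inverse (poly g' s) \<in> W" using unitD[OF W(1)] poly_unit[OF W(1) g'(1) W(2) g'(3)] by blast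
    moreover have "poly f' s \<in> W" by (rule poly_in_V[OF W(1) l(2) nonunits_subset[OF W]])
    ultimately show "poly f' s / poly g' s \<in> W"
      unfolding divide_inverse using V_closed(6)[OF W(1)] by blast
  qed
qed

end

section \<open>Integrality over \<open>F[y]\<close> and the pigeonhole argument\<close>

context function_field
begin

text \<open>Transcendence of \<open>y\<close> ensures that a nontrivial dependence between the
  powers of \<open>w\<close> has a nonzero coefficient after evaluation at \<open>y\<close>.\<close>

lemma algebraic_relation:
  assumes "\<And>f. f \<in> polys_over F \<Longrightarrow> f \<noteq> 0 \<Longrightarrow> poly f y \<noteq> 0"
  obtains p where "p \<noteq> 0" "\<And>i. \<exists>f\<in>polys_over F. coeff p i = poly f y" "poly p w = 0"
proof -
  obtain n where "\<forall>z :: nat \<Rightarrow> 'k. \<exists>f. (\<forall>i. f i \<in> polys_over F) \<and> (\<exists>i\<le>n. f i \<noteq> 0) \<and>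
     (\<Sum>i\<le>n. poly (f i) y * z i) = 0"
    using dependent_over_polys[of y] by blast
  from spec[OF this, of "\<lambda>i. w ^ i"]
  obtain f i0 where f: "\<And>i. f i \<in> polys_over F" "i0 \<le> n" "f i0 \<noteq> 0"
    "(\<Sum>i\<le>n. poly (f i) y * w ^ i) = 0"
    by blast
  define p where "p = (\<Sum>i\<le>n. monom (poly (f i) y) i)"
  have coeff: "coeff p i = (if i \<le> n then poly (f i) y else 0)" for i
    by (simp add: p_def coeff_sum)
  show thesis
  proof (rule that)
    have "coeff p i0 \<noteq> 0" using coeff f(2) assms[OF f(1,3)] by simp
    then show "p \<noteq> 0" by auto
    show "\<exists>f\<in>polys_over F. coeff p i = poly f y" for i
    proof (cases "i \<le> n")
      case False
      then show ?thesis using coeff by (intro bexI[of _ 0]) (auto intro: PF_closed)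
    qed (use coeff f(1) in auto)
    show "poly p w = 0" using f(4) by (simp add: p_def poly_sum poly_monom)
  qed
qed

text \<open>The leading coefficient of an equation for \<open>w\<close> over \<open>F[y]\<close>
  clears the poles of \<open>w\<close> in all valuation rings containing \<open>y\<close>
  simultaneously.\<close>

lemma integral_multiple:
  assumes "\<And>f. f \<in> polys_over F \<Longrightarrow> f \<noteq> 0 \<Longrightarrow> poly f y \<noteq> 0"
  obtains g where "g \<in> polys_over F" "g \<noteq> 0"
    "\<And>W. valring W \<Longrightarrow> y \<in> W \<Longrightarrow> poly g y * w \<in> W"
proof -
  obtain p where p: "p \<noteq> 0" "\<And>i. \<exists>f\<in>polys_over F. coeff p i = poly f y" "poly p w = 0"
    using algebraic_relation[of y w] assms by metis
  obtain g where g: "g \<in> polys_over F" "lead_coeff p = poly g y" using p(2) by blast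
  show thesis
  proof (rule that)
    show "g \<noteq> 0" using p(1) g(2) by auto
    fix W assume W: "valring W" "y \<in> W"
    have "coeff p i \<in> W" for i
      using p(2)[of i] poly_in_V[OF W(1) _ W(2)] by auto
    then have "p \<in> polys_over W" by (simp add: polys_over_def)
    from lead_coeff_mult_root[OF W(1) this p(1,3)] g(2) show "poly g y * w \<in> W" by simp
  qed fact
qed

text \<open>Multiplication by \<open>z\<close> shifts the coefficients, and \<open>rel\<close>
  rewrites the overflowing top power.\<close>

lemma powers_in_span:
  assumes E: "ring_set E" and rel: "z ^ Suc r = (\<Sum>i<Suc r. \<rho> i * z ^ i)" and \<rho>: "\<And>i. \<rho> i \<in> E"
  shows "\<exists>R. (\<forall>i. R i \<in> E) \<and> z ^ k = (\<Sum>i<Suc r. R i * z ^ i)"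
proof (induction k)
  case 0
  have "(\<Sum>i<Suc r. (if i = 0 then 1 else 0) * z ^ i) = 1"
    by (subst sum.lessThan_Suc_shift) simp
  then show ?case
    by (intro exI[of _ "\<lambda>i. if i = 0 then 1 else 0"]) (simp add: ring_set_closed[OF E])
next
  case (Suc k)
  then obtain R where R: "\<And>i. R i \<in> E" "z ^ k = (\<Sum>i<Suc r. R i * z ^ i)" by blast
  define R' where "R' i = (if i = 0 then 0 else R (i - 1)) + R r * \<rho> i" for i
  have "z ^ Suc k = (\<Sum>i<r. R i * z ^ Suc i) + R r * z ^ Suc r"
    by (simp add: R(2) sum_distrib_left algebra_simps)
  also have "(\<Sum>i<r. R i * z ^ Suc i) = (\<Sum>i<Suc r. (if i = 0 then 0 else R (i - 1)) * z ^ i)"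
    by (subst sum.lessThan_Suc_shift) simp
  also have "R r * z ^ Suc r = (\<Sum>i<Suc r. R r * \<rho> i * z ^ i)"
    unfolding rel sum_distrib_left by (simp only: mult.assoc)
  finally have "z ^ Suc k = (\<Sum>i<Suc r. R' i * z ^ i)"
    by (simp only: R'_def distrib_right sum.distrib)
  moreover have "R' i \<in> E" for i
    unfolding R'_def using R(1) \<rho> by (auto intro: ring_set_closed[OF E])
  ultimately show ?case by blast
qed

text \<open>With \<open>B\<close> and \<open>O\<close> the functions that are regular away from, respectively at, the poles of
  \<open>t\<close>, the powers \<open>z ^ k\<close> meet only finitely many classes modulo \<open>B + O\<close>.  If \<open>z\<close> has \<open>V\<close> as its
  only pole among the poles of \<open>t\<close>, writing \<open>z ^ k - z ^ j = b + o\<close> yields \<open>b\<close> with a pole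
  at \<open>V\<close> and no other pole.\<close>

lemma pole_only_at:
  assumes V: "valring V" and t: "t \<notin> V"
  obtains y where "y \<notin> V" "\<And>W. valring W \<Longrightarrow> W \<noteq> V \<Longrightarrow> y \<in> W"
proof -
  define s where "s = inverse t"
  have s: "s \<noteq> 0" "s \<in> nonunits V" and st: "t = inverse s"
    using inverse_in_nonunits[OF V t] by (auto simp: s_def)
  have t_trans: "poly f t \<noteq> 0" if "f \<in> polys_over F" "f \<noteq> 0" for f
    using poly_neq_0_if_notin_V[OF V t that] .
  have s_trans: "poly f s \<noteq> 0" if f: "f \<in> polys_over F" "f \<noteq> 0" for f
  proof -
    obtain k q where q: "q \<in> polys_over F" "f = monom 1 k * q" "coeff q 0 \<noteq> 0"
      using poly_split_monom[OF f ring_F] .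
    have "poly q s \<noteq> 0" using unitD[OF V poly_unit[OF V q(1) s(2) q(3)]] by blast
    then show ?thesis using s(1) by (simp add: q(2) poly_monom)
  qed
  define inB where "inB y \<longleftrightarrow> (\<forall>W. valring W \<longrightarrow> t \<in> W \<longrightarrow> y \<in> W)" for y
  define inO where "inO y \<longleftrightarrow> (\<forall>W. valring W \<longrightarrow> s \<in> nonunits W \<longrightarrow> y \<in> W)" for y
  obtain z where z: "z \<notin> V" "\<And>W. valring W \<Longrightarrow> s \<in> nonunits W \<Longrightarrow> W \<noteq> V \<Longrightarrow> z \<in> W"
    using pole_at_one_valring[OF s(1) V s(2)] by blast
  obtain p where p: "p \<noteq> 0" "\<And>i. \<exists>f\<in>polys_over F. coeff p i = poly f t" "poly p z = 0"
    using algebraic_relation[of t z] t_trans by metis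
  define h where "h = lead_coeff p"
  have h: "h \<noteq> 0" using p(1) by (simp add: h_def)
  have t_ratl: "t \<in> ratl s" unfolding st by (intro inverse_in_ratl base_in_ratl)
  have p_ratl: "coeff p i \<in> ratl s" for i
  proof -
    obtain f where f: "f \<in> polys_over F" "coeff p i = poly f t" using p(2) by blast
    have "f \<in> polys_over (ratl s)" using f(1) F_in_ratl by (auto simp: polys_over_def)
    then show ?thesis unfolding f(2) by (rule poly_in_ring_set[OF ring_set_ratl _ t_ratl])
  qed
  \<comment> \<open>The factor \<open>h\<close> removes the poles of \<open>z\<close> away from the
    poles of \<open>t\<close>. Since \<open>h\<close> is a nonzero element of \<open>F(s)\<close>,
    the powers of \<open>w\<close> span the same space over \<open>F(s)\<close> as those of
    \<open>z\<close>.\<close>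
  define w where "w = h * z"
  have wB: "inB w"
    unfolding inB_def w_def h_def
  proof (intro allI impI)
    fix W assume W: "valring W" "t \<in> W"
    have "coeff p i \<in> W" for i
      using p(2)[of i] poly_in_V[OF W(1) _ W(2)] by auto
    then have "p \<in> polys_over W" by (simp add: polys_over_def)
    from lead_coeff_mult_root[OF W(1) this p(1,3)] show "lead_coeff p * z \<in> W" .
  qed
  have "degree p \<noteq> 0"
  proof
    assume "degree p = 0"
    then obtain a where "p = [:a:]" by (rule degree_eq_zeroE)
    then show False using p(1,3) by simp
  qed
  then obtain r where r: "degree p = Suc r" by (cases "degree p") auto
  define \<rho> where "\<rho> i = - (coeff p i * inverse h)" for i
  have \<rho>: "\<rho> i \<in> ratl s" for i
    unfolding \<rho>_def using p_ratl by (auto simp: h_def intro!: ratl_closed inverse_in_ratl)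
  have "(\<Sum>i<Suc r. coeff p i * z ^ i) + h * z ^ Suc r = 0"
    using p(3) unfolding poly_altdef h_def r lessThan_Suc_atMost[symmetric] by (simp only: sum.lessThan_Suc)
  then have top: "h * z ^ Suc r = - (\<Sum>i<Suc r. coeff p i * z ^ i)"
    by (metis add.commute eq_neg_iff_add_eq_0)
  have "z ^ Suc r = inverse h * (h * z ^ Suc r)"
    by (simp only: mult.assoc[symmetric] left_inverse[OF h] mult_1)
  also have "\<dots> = (\<Sum>i<Suc r. inverse h * - (coeff p i * z ^ i))"
    unfolding top sum_negf[symmetric] sum_distrib_left ..
  also have "\<dots> = (\<Sum>i<Suc r. \<rho> i * z ^ i)"
    by (rule sum.cong) (simp_all add: \<rho>_def)
  finally have rel: "z ^ Suc r = (\<Sum>i<Suc r. \<rho> i * z ^ i)" .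
  obtain g where g: "g \<in> polys_over F" "g \<noteq> 0" "\<And>W. valring W \<Longrightarrow> s \<in> W \<Longrightarrow> poly g s * w \<in> W"
    using integral_multiple[of s w] s_trans by metis
  \<comment> \<open>At the zeros of \<open>s\<close> the factor \<open>poly g' s\<close> is a unit,
    so \<open>s ^ c0\<close> alone cancels the poles of \<open>w\<close> there.\<close>
  obtain c0 g' where g': "g' \<in> polys_over F" "g = monom 1 c0 * g'" "coeff g' 0 \<noteq> 0"
    using poly_split_monom[OF g(1,2) ring_F] .
  have c0: "inO (s ^ c0 * w)"
    unfolding inO_def
  proof (intro allI impI)
    fix W assume W: "valring W" "s \<in> nonunits W"
    have u: "poly g' s \<noteq> 0" "inverse (poly g' s) \<in> W"
      using unitD[OF W(1) poly_unit[OF W(1) g'(1) W(2) g'(3)]] by blast+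
    have "inverse (poly g' s) * (poly g s * w) \<in> W"
      using V_closed(6)[OF W(1) u(2) g(3)[OF W(1) nonunits_subset[OF W]]] .
    also have "inverse (poly g' s) * (poly g s * w) = s ^ c0 * w"
      using u(1) by (simp add: g'(2) poly_monom)
    finally show "s ^ c0 * w \<in> W" .
  qed
  \<comment> \<open>One exponent for all the powers of \<open>w\<close> up to
    \<open>r\<close>.\<close>
  define c where "c = c0 * r"
  have c: "inO (s ^ c * w ^ i)" if "i < Suc r" for i
    unfolding inO_def
  proof (intro allI impI)
    fix W assume W: "valring W" "s \<in> nonunits W"
    have "c = c0 * (r - i) + c0 * i" using that by (simp add: c_def flip: distrib_left)
    then have "s ^ c * w ^ i = s ^ (c0 * (r - i)) * (s ^ c0 * w) ^ i"
      by (simp add: power_add power_mult power_mult_distrib)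
    also have "\<dots> \<in> W"
      using c0 W nonunits_subset[OF W]
      by (intro V_closed(6)[OF W(1) V_closed(8)[OF W(1)] V_closed(8)[OF W(1)]]) (auto simp: inO_def)
    finally show "s ^ c * w ^ i \<in> W" .
  qed
  define Pc where "Pc = {l \<in> polys_over F. degree l \<le> c}"
  \<comment> \<open>In each coefficient the polynomial in \<open>t\<close> contributes to
    \<open>B\<close>, as \<open>w\<close> lies there; the remainder \<open>s ^ c * v\<close>
    contributes to \<open>O\<close> by the choice of \<open>c\<close>; and the finitely many
    \<open>l\<close> label the classes.\<close>
  have "\<exists>l\<in>{..<Suc r} \<rightarrow>\<^sub>E Pc. \<exists>\<beta> \<omega>. inB \<beta> \<and> inO \<omega> \<and> z ^ k = \<beta> + \<omega> + (\<Sum>i<Suc r. poly (l i) s * w ^ i)" for k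
  proof -
    obtain R where R: "\<And>i. R i \<in> ratl s" "z ^ k = (\<Sum>i<Suc r. R i * z ^ i)"
      using powers_in_span[OF ring_set_ratl rel \<rho>] by blast
    define R' where "R' i = R i * inverse h ^ i" for i
    have "R' i \<in> ratl s" for i
      unfolding R'_def h_def by (intro ratl_closed R inverse_in_ratl p_ratl)
    then have "\<exists>A l v. A \<in> polys_over F \<and> l \<in> polys_over F \<and> degree l \<le> c \<and>
        R' i = poly A t + poly l s + s ^ c * v \<and> inO v" for i
      using ratl_decomposition[OF s(1), of "R' i" c] unfolding st inO_def by metis
    then obtain A l v where Alv: "\<And>i. A i \<in> polys_over F" "\<And>i. l i \<in> polys_over F" "\<And>i. degree (l i) \<le> c"
        "\<And>i. R' i = poly (A i) t + poly (l i) s + s ^ c * v i" "\<And>i. inO (v i)"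
      by metis
    have "z ^ k = (\<Sum>i<Suc r. R' i * w ^ i)"
      unfolding R(2) R'_def w_def using h by (simp add: power_mult_distrib field_simps)
    also have "\<dots> = (\<Sum>i<Suc r. poly (A i) t * w ^ i) + (\<Sum>i<Suc r. v i * (s ^ c * w ^ i))
        + (\<Sum>i<Suc r. poly (l i) s * w ^ i)"
      unfolding sum.distrib[symmetric] Alv(4) by (rule sum.cong) (simp_all add: algebra_simps)
    also have "(\<Sum>i<Suc r. poly (l i) s * w ^ i) = (\<Sum>i<Suc r. poly (restrict l {..<Suc r} i) s * w ^ i)"
      by (rule sum.cong) simp_all
    finally have "z ^ k = (\<Sum>i<Suc r. poly (A i) t * w ^ i) + (\<Sum>i<Suc r. v i * (s ^ c * w ^ i))
        + (\<Sum>i<Suc r. poly (restrict l {..<Suc r} i) s * w ^ i)" .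
    moreover have "inB (\<Sum>i<Suc r. poly (A i) t * w ^ i)"
      unfolding inB_def
    proof (intro allI impI)
      fix W assume W: "valring W" "t \<in> W"
      then have "w \<in> W" using wB by (simp add: inB_def)
      then show "(\<Sum>i<Suc r. poly (A i) t * w ^ i) \<in> W"
        by (intro V_closed[OF W(1)] poly_in_V[OF W(1)] Alv W)
    qed
    moreover have "inO (\<Sum>i<Suc r. v i * (s ^ c * w ^ i))"
      unfolding inO_def
    proof (intro allI impI)
      fix W assume W: "valring W" "s \<in> nonunits W"
      have "v i * (s ^ c * w ^ i) \<in> W" if "i < Suc r" for i
        using V_closed(6)[OF W(1)] Alv(5) c[OF that] W by (simp add: inO_def)
      then show "(\<Sum>i<Suc r. v i * (s ^ c * w ^ i)) \<in> W"
        by (intro V_closed(7)[OF W(1)]) simp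
    qed
    moreover have "restrict l {..<Suc r} \<in> {..<Suc r} \<rightarrow>\<^sub>E Pc"
      using Alv by (auto simp: Pc_def)
    ultimately show ?thesis by blast
  qed
  moreover define cls where "cls k l \<beta> \<omega> \<longleftrightarrow> l \<in> {..<Suc r} \<rightarrow>\<^sub>E Pc \<and> inB \<beta> \<and> inO \<omega> \<and>
      z ^ k = \<beta> + \<omega> + (\<Sum>i<Suc r. poly (l i) s * w ^ i)" for k l \<beta> \<omega>
  ultimately have "\<exists>l \<beta> \<omega>. cls k l \<beta> \<omega>" for k by blast
  then obtain l \<beta> \<omega> where "\<And>k. cls k (l k) (\<beta> k) (\<omega> k)" by metis
  then have l: "\<And>k. l k \<in> {..<Suc r} \<rightarrow>\<^sub>E Pc"
    and zk: "\<And>k. inB (\<beta> k)" "\<And>k. inO (\<omega> k)"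
      "\<And>k. z ^ k = \<beta> k + \<omega> k + (\<Sum>i<Suc r. poly (l k i) s * w ^ i)"
    unfolding cls_def by blast+
  have "finite ({..<Suc r} \<rightarrow>\<^sub>E Pc)"
    unfolding Pc_def by (intro finite_PiE finite_polys_over_degree_le finite_F) simp
  then have "finite (range l)" by (rule finite_subset[rotated]) (use l in auto)
  then have "\<not> inj l" using finite_imageD infinite_UNIV_nat by blast
  then obtain j k where jk: "j < k" "l j = l k"
    by (metis injI linorder_neqE_nat)
  \<comment> \<open>For equal labels \<open>y\<close> is also \<open>\<beta> k - \<beta> j\<close>,
    hence regular wherever \<open>t\<close> is. The defining expression shows regularity at the
    other poles of \<open>t\<close>, and the pole at \<open>V\<close>, which
    \<open>z ^ k - z ^ j\<close> inherits from \<open>z\<close>.\<close>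
  define y where "y = z ^ k - z ^ j - (\<omega> k - \<omega> j)"
  have y: "y = \<beta> k - \<beta> j" unfolding y_def zk(3) jk(2) by simp
  show thesis
  proof (rule that)
    have "poly (monom 1 k - monom 1 j) z \<notin> V"
    proof (rule poly_notin_V[OF V z(1)])
      show "monom 1 k - monom 1 j \<in> polys_over F" by (intro PF_closed F_closed)
      have "coeff (monom 1 k - monom 1 j :: 'k poly) k \<noteq> 0" using jk(1) by simp
      then have "k \<le> degree (monom 1 k - monom 1 j :: 'k poly)" by (rule le_degree)
      then show "0 < degree (monom 1 k - monom 1 j :: 'k poly)" using jk(1) by simp
    qed
    then have *: "z ^ k - z ^ j \<notin> V" by (simp add: poly_monom)
    show "y \<notin> V"
    proof
      assume "y \<in> V"
      moreover have "\<omega> k - \<omega> j \<in> V" using zk(2) V s(2) by (intro V_closed[OF V]) (auto simp: inO_def)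
      ultimately have "y + (\<omega> k - \<omega> j) \<in> V" by (rule V_closed[OF V])
      with * show False by (simp add: y_def)
    qed
    fix W assume W: "valring W" "W \<noteq> V"
    show "y \<in> W"
    proof (cases "t \<in> W")
      case True
      then show ?thesis unfolding y using zk(1) W by (intro V_closed[OF W(1)]) (auto simp: inB_def)
    next
      case False
      then have "s \<in> nonunits W" using inverse_in_nonunits[OF W(1)] by (simp add: s_def)
      then show ?thesis unfolding y_def using zk(2) W z(2)
        by (intro V_closed[OF W(1)]) (auto simp: inO_def)
    qed
  qed
qed

text \<open>If \<open>b\<close> has its only pole at \<open>V\<close>, then \<open>b\<close> is
  transcendental and lies in \<open>A\<close>, and \<open>integral_multiple\<close> over
  \<open>F[b]\<close> yields a denominator for \<open>y\<close>.\<close>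

lemma regular_fraction:
  assumes V: "valring V" "V \<noteq> UNIV"
  defines "A \<equiv> \<Inter>{W. valring W \<and> W \<noteq> V}"
  shows "\<exists>a\<in>A. \<exists>c\<in>A. c \<noteq> 0 \<and> y * c = a"
proof -
  obtain t where "t \<notin> V" using V(2) by blast
  then obtain b where b: "b \<notin> V" "\<And>W. valring W \<Longrightarrow> W \<noteq> V \<Longrightarrow> b \<in> W"
    using pole_only_at[OF V(1)] by metis
  have trans: "poly f b \<noteq> 0" if "f \<in> polys_over F" "f \<noteq> 0" for f
    using poly_neq_0_if_notin_V[OF V(1) b(1) that] .
  obtain g where g: "g \<in> polys_over F" "g \<noteq> 0" "\<And>W. valring W \<Longrightarrow> b \<in> W \<Longrightarrow> poly g b * y \<in> W"
    using integral_multiple[of b y] trans by metis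
  have "poly g b \<in> A" "poly g b * y \<in> A"
    using b(2) g poly_in_V by (auto simp: A_def)
  then show ?thesis
    using trans[OF g(1,2)] by (intro bexI[of _ "poly g b * y"] bexI[of _ "poly g b"]) (simp_all add: mult.commute)
qed

end

section \<open>Unipotent elements and stabilizers\<close>

definition m2 :: "'k::field \<Rightarrow> 'k \<Rightarrow> 'k \<Rightarrow> 'k \<Rightarrow> 'k ^ 2 ^ 2"
  where "m2 a b c d = (\<chi> i j. if i = 1 then (if j = 1 then a else b) else (if j = 1 then c else d))"

lemma m2_nth [simp]:
  "m2 a b c d $ 1 $ 1 = a" "m2 a b c d $ 1 $ 2 = b"
  "m2 a b c d $ 2 $ 1 = c" "m2 a b c d $ 2 $ 2 = d"
  by (simp_all add: m2_def)

lemma m2_exhaust: obtains a b c d where "M = m2 a b c d"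
proof
  show "M = m2 (M $ 1 $ 1) (M $ 1 $ 2) (M $ 2 $ 1) (M $ 2 $ 2)"
    by (simp add: vec_eq_iff forall_2)
qed

lemma m2_eq_iff [simp]: "m2 a b c d = m2 a' b' c' d' \<longleftrightarrow> a = a' \<and> b = b' \<and> c = c' \<and> d = d'"
  by (auto simp: vec_eq_iff forall_2)

lemma m2_mult [simp]:
  "m2 a b c d ** m2 a' b' c' d' =
    m2 (a * a' + b * c') (a * b' + b * d') (c * a' + d * c') (c * b' + d * d')"
  by (simp add: vec_eq_iff forall_2 matrix_matrix_mult_def sum_2)

lemma m2_add: "m2 a b c d + m2 a' b' c' d' = m2 (a + a') (b + b') (c + c') (d + d')"
  by (simp add: vec_eq_iff forall_2)

lemma matrix_add_rdistrib: "(B + C) ** A = B ** A + C ** A"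
  for A B C :: "'k::field ^ 2 ^ 2"
  by (simp add: vec_eq_iff forall_2 matrix_matrix_mult_def sum_2 algebra_simps)

lemma mat_m2: "mat x = m2 x 0 0 x"
  by (simp add: vec_eq_iff forall_2 mat_def)

lemma det_m2 [simp]: "det (m2 a b c d) = a * d - b * c"
  by (simp add: det_2)

text \<open>Up to sign, this is the determinant with columns \<open>M v\<close> and
  \<open>v\<close>, where \<open>v\<close> is \<open>(z, 1)\<close> or \<open>(1, 0)\<close>; it
  vanishes when \<open>M\<close> preserves the line of \<open>v\<close>.\<close>

fun fixform :: "'k::field ^ 2 ^ 2 \<Rightarrow> 'k proj_line \<Rightarrow> 'k" where
  "fixform M (Fin z) = M $ 1 $ 2 + (M $ 1 $ 1 - M $ 2 $ 2) * z - M $ 2 $ 1 * z\<^sup>2"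
| "fixform M Infty = M $ 2 $ 1"

lemma mobius_act_fix_iff:
  assumes "det M \<noteq> 0"
  shows "mobius_act M s = s \<longleftrightarrow> fixform M s = 0"
proof (cases s)
  case (Fin z)
  obtain a b c d where M: "M = m2 a b c d" by (rule m2_exhaust)
  \<comment> \<open>Here \<open>z\<close> is sent to \<open>Infty\<close>; if the form vanished as
    well, \<open>(z, 1)\<close> would be a kernel vector of \<open>M\<close>.\<close>
  have "c * z + d = 0 \<Longrightarrow> b + (a - d) * z - c * z\<^sup>2 \<noteq> 0"
  proof
    assume *: "c * z + d = 0" "b + (a - d) * z - c * z\<^sup>2 = 0"
    from *(1) have d: "d = - (c * z)" by (simp add: eq_neg_iff_add_eq_0 add.commute)
    from *(2) have "b = - (a * z)" unfolding d by (simp add: algebra_simps power2_eq_square eq_neg_iff_add_eq_0)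
    with d have "a * d - b * c = 0" by (simp add: algebra_simps)
    with assms M show False by simp
  qed
  moreover have "c * z + d \<noteq> 0 \<Longrightarrow> (a * z + b) / (c * z + d) = z \<longleftrightarrow> b + (a - d) * z - c * z\<^sup>2 = 0"
    by (auto simp: field_simps power2_eq_square)
  ultimately show ?thesis
    by (auto simp: Fin M moebius_def)
qed auto

text \<open>The nilpotent matrices with kernel the line \<open>s\<close>.\<close>

fun nilp :: "'k::field proj_line \<Rightarrow> 'k \<Rightarrow> 'k ^ 2 ^ 2" where
  "nilp (Fin z) l = m2 (- l * z) (l * z\<^sup>2) (- l) (l * z)"
| "nilp Infty l = m2 0 l 0 0"

text \<open>If \<open>N\<close> is a nonzero nilpotent matrix with kernel the line \<open>s\<close>, then \<open>g N g\<inverse>\<close> has kernel \<open>g s\<close>,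
  and two such matrices commute only if their kernels agree.\<close>

lemma conj_unipotent_commute_iff:
  fixes s :: "'k::field proj_line"
  assumes gh: "g ** h = mat 1" and l: "l \<noteq> 0"
  defines "u \<equiv> mat 1 + nilp s l"
  shows "g ** u ** h ** u = u ** (g ** u ** h) \<longleftrightarrow> fixform g s = 0"
proof -
  obtain a b c d where g: "g = m2 a b c d" by (rule m2_exhaust)
  obtain a' b' c' d' where h: "h = m2 a' b' c' d'" by (rule m2_exhaust)
  have "det g * det h = 1"
    using arg_cong[OF gh, of det] by (simp add: det_mul)
  then have "(a * d - b * c) * (a' * d' - b' * c') = 1"
    by (simp add: g h)
  then have i: "(a * d - b * c) * (a' * d' - b' * c') = 1" "a' * d' - b' * c' \<noteq> 0" by auto
  define i where "i = a' * d' - b' * c'"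
  have e: "a * a' + b * c' = 1" "a * b' + b * d' = 0" "c * a' + d * c' = 0" "c * b' + d * d' = 1"
    using gh by (simp_all add: g h mat_m2)
  have i0: "i \<noteq> 0" using i(2) by (simp add: i_def)
  have ie: "i * (a * d - b * c) = 1" using i by (simp add: i_def mult.commute)
  \<comment> \<open>Cramer's rule: \<open>h\<close> is \<open>i\<close> times the adjugate of
    \<open>g\<close>.\<close>
  have "(a * d - b * c) * a' = d * (a * a' + b * c') - b * (c * a' + d * c')"
    "(a * d - b * c) * b' = d * (a * b' + b * d') - b * (c * b' + d * d')"
    "(a * d - b * c) * c' = a * (c * a' + d * c') - c * (a * a' + b * c')"
    "(a * d - b * c) * d' = a * (c * b' + d * d') - c * (a * b' + b * d')"
    by (simp_all add: algebra_simps)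
  then have "(a * d - b * c) * a' = d" "(a * d - b * c) * b' = - b"
    "(a * d - b * c) * c' = - c" "(a * d - b * c) * d' = a"
    unfolding e by simp_all
  then have ei: "a' = i * d" "b' = i * (- b)" "c' = i * (- c)" "d' = i * a"
    by (metis ie mult.assoc mult_1)+
  have "g ** u ** h = mat 1 + g ** nilp s l ** h"
    by (simp add: u_def matrix_add_ldistrib matrix_add_rdistrib gh)
  then have comm: "g ** u ** h ** u = u ** (g ** u ** h) \<longleftrightarrow>
      g ** nilp s l ** h ** nilp s l = nilp s l ** (g ** nilp s l ** h)"
    by (simp add: u_def matrix_add_ldistrib matrix_add_rdistrib add_ac)
  show ?thesis
  proof (cases s)
    case Infty
    have "g ** nilp s l ** h = m2 (- i * l * a * c) (i * l * a * a) (- i * l * c * c) (i * l * a * c)"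
      by (simp add: Infty g h ei algebra_simps)
    then show ?thesis
      unfolding comm using i0 l by (auto simp: Infty g)
  next
    case (Fin z)
    \<comment> \<open>\<open>(p, r)\<close> is the image of \<open>(z, 1)\<close> under
      \<open>g\<close>; it spans the kernel of the conjugated nilpotent.\<close>
    define p r where "p = a * z + b" and "r = c * z + d"
    have gnh: "g ** nilp s l ** h = m2 (- i * l * p * r) (i * l * p * p) (- i * l * r * r) (i * l * p * r)"
      by (simp add: Fin g h ei p_def r_def algebra_simps power2_eq_square)
    have form: "fixform g s = p - z * r"
      by (simp add: Fin g p_def r_def algebra_simps power2_eq_square)
    show ?thesis
    proof
      assume "fixform g s = 0"
      then have "p = z * r" using form by simp
      then show "g ** u ** h ** u = u ** (g ** u ** h)"
        unfolding comm gnh by (simp add: Fin algebra_simps power2_eq_square)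
    next
      assume "g ** u ** h ** u = u ** (g ** u ** h)"
      then have eq: "nilp s l ** (g ** nilp s l ** h) - g ** nilp s l ** h ** nilp s l = 0"
        unfolding comm by simp
      have "(nilp s l ** (g ** nilp s l ** h) - g ** nilp s l ** h ** nilp s l) $ 1 $ 1 =
          (i * l * l) * ((p - z * r) * (p + z * r))"
        "(nilp s l ** (g ** nilp s l ** h) - g ** nilp s l ** h ** nilp s l) $ 2 $ 1 =
          (i * l * l) * ((p - z * r) * (2 * r))"
        unfolding gnh by (simp_all add: Fin power2_eq_square algebra_simps)
      then have "(i * l * l) * ((p - z * r) * (p + z * r)) = 0" "(i * l * l) * ((p - z * r) * (2 * r)) = 0"
        unfolding eq by simp_all
      then have "(p - z * r) * (p + z * r) = 0" "(p - z * r) * (2 * r) = 0"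
        using i0 l by auto
      \<comment> \<open>This combination gives the square in every characteristic, without division
        by 2.\<close>
      moreover have "(p - z * r) * (p - z * r) = (p - z * r) * (p + z * r) - z * ((p - z * r) * (2 * r))"
        by (simp add: algebra_simps)
      ultimately have "(p - z * r) * (p - z * r) = 0"
        by (simp only: mult_zero_right diff_zero)
      then show "fixform g s = 0"
        unfolding form by (metis mult_eq_0_iff)
    qed
  qed
qed

text \<open>Horner evaluation of a polynomial at a matrix. Powers of \<open>mat 1 + N\<close> become
  values of \<open>[:1, 1:] ^ k\<close>, so identities between commuting polynomials carry over to
  matrices.\<close>

definition mpoly :: "'k::field poly \<Rightarrow> 'k ^ 2 ^ 2 \<Rightarrow> 'k ^ 2 ^ 2"
  where "mpoly p N = fold_coeffs (\<lambda>a M. mat a + N ** M) p 0"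

lemma mpoly_0 [simp]: "mpoly 0 N = 0"
  by (simp add: mpoly_def)

lemma mpoly_pCons [simp]: "mpoly (pCons a p) N = mat a + N ** mpoly p N"
  by (cases "p = 0 \<and> a = 0") (auto simp: mpoly_def)

lemma mat_add: "mat (a + b) = mat a + (mat b :: 'k::field ^ 2 ^ 2)"
  by (simp add: mat_m2 m2_add)

lemma mat_mult_commute: "mat a ** N = N ** mat a"
  for N :: "'k::field ^ 2 ^ 2"
  by (rule m2_exhaust[of N]) (simp add: mat_m2 mult.commute)

lemma mpoly_add: "mpoly (p + q) N = mpoly p N + mpoly q N"
proof (induction p arbitrary: q)
  case (pCons a p)
  obtain b q' where q: "q = pCons b q'" by (cases q)
  have "mpoly (pCons a p + q) N = mat (a + b) + N ** (mpoly p N + mpoly q' N)"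
    by (simp add: q pCons)
  then show ?case
    by (simp add: q mat_add matrix_add_ldistrib add_ac)
qed simp

lemma mpoly_smult: "mpoly (smult a p) N = mat a ** mpoly p N"
proof (induction p)
  case (pCons b p)
  have "mat (a * b) = mat a ** (mat b :: 'a ^ 2 ^ 2)" by (simp add: mat_m2)
  moreover have "N ** (mat a ** mpoly p N) = mat a ** (N ** mpoly p N)"
    by (metis mat_mult_commute matrix_mul_assoc)
  ultimately show ?case
    by (simp add: pCons matrix_add_ldistrib)
qed simp

lemma mpoly_mult: "mpoly (p * q) N = mpoly p N ** mpoly q N"
  by (induction p) (simp_all add: mpoly_add mpoly_smult matrix_add_rdistrib matrix_mul_assoc)

text \<open>In characteristic \<open>p\<close>, the relation \<open>u\<^sup>p = 1\<close> says \<open>(u - 1)\<^sup>p = 0\<close>, so \<open>u - 1\<close> is nilpotent.\<close>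

lemma nilp_if_power_char:
  fixes N :: "'k::field ^ 2 ^ 2"
  assumes p: "Factorial_Ring.prime CHAR('k)" and N: "N \<noteq> 0"
    and pow: "mpoly ([:1, 1:] ^ CHAR('k)) N = mat 1"
  obtains s l where "l \<noteq> 0" "N = nilp s l"
proof -
  define p where "p = CHAR('k)"
  have "[:1, 1:] ^ p = ([:0, 1:] + 1 :: 'k poly) ^ p"
    by (simp add: one_pCons)
  also have "\<dots> = [:0, 1:] ^ p + 1"
    using freshmans_dream[of p "[:0, 1:] :: 'k poly" 1] p by (simp add: p_def)
  finally have "mpoly ([:0, 1:] ^ p) N + mat 1 = mat 1"
    using pow by (simp add: p_def[symmetric] mpoly_add one_pCons)
  then have pow0: "mpoly ([:0, 1:] ^ p) N = 0" by simp
  have p0: "p \<noteq> 0" using p by (auto simp: p_def)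
  obtain a b c d where abcd: "N = m2 a b c d" by (rule m2_exhaust)
  have "det (mpoly ([:0, 1:] ^ k) N) = det N ^ k" for k
    by (induction k) (simp_all add: one_pCons mpoly_mult det_mul mat_0 del: mult_pCons_left)
  from this[of p, symmetric] have "det N ^ p = 0" by (simp add: pow0 det_2)
  then have det: "a * d = b * c" by (simp add: abcd)
  \<comment> \<open>As \<open>det N = 0\<close>, Cayley-Hamilton says that \<open>N\<close> squared
    is the trace times \<open>N\<close>. Since a power of \<open>N\<close> vanishes but
    \<open>N\<close> does not, the trace is 0.\<close>
  have "mpoly ([:0, 1:] ^ Suc k) N = mat ((a + d) ^ k) ** N" for k
  proof (induction k)
    case (Suc k)
    have sq: "N ** N = mat (a + d) ** N"
      using det by (simp add: abcd mat_m2 algebra_simps)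
    have "mpoly ([:0, 1:] ^ Suc (Suc k)) N = N ** mpoly ([:0, 1:] ^ Suc k) N"
      by (subst power_Suc, subst mpoly_mult) simp
    also have "\<dots> = mat ((a + d) ^ k) ** (N ** N)"
      unfolding Suc by (metis mat_mult_commute matrix_mul_assoc)
    also have "\<dots> = mat ((a + d) ^ Suc k) ** N"
      unfolding sq by (simp add: abcd mat_m2 algebra_simps)
    finally show ?case .
  qed (simp add: one_pCons)
  from this[of "p - 1"] pow0 p0 have "mat ((a + d) ^ (p - 1)) ** N = 0" by simp
  have zero: "m2 a b c d = 0 \<longleftrightarrow> a = 0 \<and> b = 0 \<and> c = 0 \<and> d = 0" for a b c d :: 'k
    by (auto simp: vec_eq_iff forall_2)
  from \<open>mat ((a + d) ^ (p - 1)) ** N = 0\<close> have tr: "a + d = 0"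
    using N by (auto simp: abcd mat_m2 zero)
  then have d: "d = - a" by (simp add: eq_neg_iff_add_eq_0 add.commute)
  show thesis
  \<comment> \<open>The kernel of \<open>N\<close> is the line \<open>Infty\<close> if
    \<open>c = 0\<close>, and is spanned by \<open>(a / c, 1)\<close> otherwise.\<close>
  proof (cases "c = 0")
    case True
    with det d have "a = 0" by simp
    with True d have "N = nilp Infty b" by (simp add: abcd)
    moreover from \<open>a = 0\<close> True d N have "b \<noteq> 0"
      by (auto simp: abcd zero)
    ultimately show thesis using that by blast
  next
    case False
    have "N = nilp (Fin (a / c)) (- c)"
      using False det d by (auto simp: abcd field_simps power2_eq_square)
    with False show thesis using that by (metis neg_equal_0_iff_equal)
  qed
qed

section \<open>Stabilizers in \<open>GL2 A\<close> under automorphisms\<close>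

context
  fixes A :: "'k::field set"
  assumes A: "ring_set A"
begin

lemma monoid_mat2: "Group.monoid (mat2_monoid A)"
proof -
  have "(M ** N) $ i $ j \<in> A" if "\<And>i j. M $ i $ j \<in> A" "\<And>i j. N $ i $ j \<in> A"
    for M N :: "'k ^ 2 ^ 2" and i j
    using that by (simp add: matrix_matrix_mult_def sum_2 ring_set_closed[OF A])
  moreover have "(mat 1 :: 'k ^ 2 ^ 2) $ i $ j \<in> A" for i j
    by (simp add: mat_def ring_set_closed[OF A])
  ultimately show ?thesis
    by (intro monoidI) (auto simp: mat2_monoid_def matrix_mul_assoc)
qed

lemma group_GL2: "Group.group (GL2 A)"
  unfolding GL2_def by (rule Group.monoid.units_group[OF monoid_mat2])

lemma GL2_simps:
  "x \<otimes>\<^bsub>GL2 A\<^esub> y = x ** y" "\<one>\<^bsub>GL2 A\<^esub> = mat 1"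
  by (simp_all add: GL2_def units_of_def mat2_monoid_def)

lemma det_GL2: "g \<in> carrier (GL2 A) \<Longrightarrow> det g \<noteq> 0"
  by (auto simp: GL2_def units_of_def Units_def mat2_monoid_def dest!: arg_cong[of _ "mat 1" det])
    (auto simp: det_mul)

lemma stabilizer_GL2:
  "stabilizer (GL2 A) mobius_act s = {g \<in> carrier (GL2 A). fixform g s = 0}"
  using det_GL2 by (auto simp: stabilizer_def mobius_act_fix_iff)

lemma GL2_pow:
  "(mat 1 + N) [^]\<^bsub>GL2 A\<^esub> (k::nat) = mpoly ([:1, 1:] ^ k) N"
proof (induction k)
  case 0
  show ?case by (simp add: GL2_simps one_pCons nat_pow_def)
next
  case (Suc k)
  have "(mat 1 + N) [^]\<^bsub>GL2 A\<^esub> Suc k = mpoly ([:1, 1:] ^ k) N ** mpoly [:1, 1:] N"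
    using Suc by (simp add: GL2_simps nat_pow_def)
  also have "\<dots> = mpoly ([:1, 1:] ^ Suc k) N"
    by (simp only: mpoly_mult[symmetric] power_Suc2)
  finally show ?case .
qed

text \<open>Scaling by the square of a denominator of \<open>s\<close> makes the nilpotent matrix
  integral over \<open>A\<close>. As its square is 0, the inverse of \<open>1 + N\<close> is
  \<open>1 - N\<close>, again over \<open>A\<close>.\<close>

lemma unipotent_in_GL2:
  assumes frac: "\<And>x. \<exists>a\<in>A. \<exists>c\<in>A. c \<noteq> 0 \<and> x * c = a"
  obtains l where "l \<noteq> 0" "mat 1 + nilp s l \<in> carrier (GL2 A)"
proof -
  have nil: "nilp s l ** nilp s l' = 0" for l l'
    by (cases s) (auto simp: vec_eq_iff forall_2 power2_eq_square algebra_simps)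
  obtain l where l: "l \<noteq> 0" and entries: "nilp s l $ i $ j \<in> A" for i j
  proof (cases s)
    case Infty
    show ?thesis
      by (rule that[of 1]) (auto simp: Infty m2_def ring_set_closed[OF A])
  next
    case (Fin z)
    obtain a c where ac: "a \<in> A" "c \<in> A" "c \<noteq> 0" "z * c = a" using frac by blast
    then have z: "c * c * z = c * a" "c * c * z\<^sup>2 = a * a"
      by (auto simp: power2_eq_square)
    show ?thesis
      by (rule that[of "c * c"]) (use ac in \<open>auto simp: Fin m2_def z ring_set_closed[OF A]\<close>)
  qed
  have in_carrier: "mat 1 + M \<in> carrier (mat2_monoid A)" if "\<And>i j. M $ i $ j \<in> A"
    for M :: "'k ^ 2 ^ 2"
    using that by (auto simp: mat2_monoid_def mat_def ring_set_closed[OF A])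
  have neg: "nilp s l + nilp s (- l) = 0" "nilp s (- l) + nilp s l = 0"
    by (cases s; simp add: vec_eq_iff forall_2)+
  then have "nilp s (- l) $ i $ j = - (nilp s l $ i $ j)" for i j
    by (metis add_eq_0_iff vector_uminus_component)
  then have "mat 1 + nilp s l \<in> carrier (mat2_monoid A)" "mat 1 + nilp s (- l) \<in> carrier (mat2_monoid A)"
    by (intro in_carrier; simp add: entries ring_set_closed[OF A])+
  moreover have "(mat 1 + nilp s l) ** (mat 1 + nilp s (- l)) = mat 1"
    "(mat 1 + nilp s (- l)) ** (mat 1 + nilp s l) = mat 1"
    by (simp_all add: matrix_add_ldistrib matrix_add_rdistrib nil neg add.assoc)
  ultimately have "mat 1 + nilp s l \<in> carrier (GL2 A)"
    unfolding GL2_def units_of_carrier Units_def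
    by (auto simp: mat2_monoid_def intro!: exI[of _ "mat 1 + nilp s (- l)"])
  with l show thesis using that by blast
qed

text \<open>Apart from \<open>A\<close> being a ring, the arithmetic of the field enters only
  through \<open>frac\<close>, which provides \<open>u\<close>, and through the characteristic,
  which makes \<open>\<sigma> u\<close> unipotent.\<close>

theorem auto_GL2_stabilizer:
  assumes frac: "\<And>x. \<exists>a\<in>A. \<exists>c\<in>A. c \<noteq> 0 \<and> x * c = a"
    and char: "Factorial_Ring.prime CHAR('k)" and \<sigma>: "\<sigma> \<in> auto (GL2 A)"
  shows "\<exists>s'. \<sigma> ` stabilizer (GL2 A) mobius_act s = stabilizer (GL2 A) mobius_act s'"
proof -
  define G where "G = GL2 A"
  have grp: "Group.group G" unfolding G_def by (rule group_GL2)
  then interpret group_hom G G \<sigma>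
    using \<sigma> by (simp add: group_hom_def group_hom_axioms_def auto_def G_def)
  have bij: "bij_betw \<sigma> (carrier G) (carrier G)"
    using \<sigma> by (simp add: auto_def Bij_def G_def)
  \<comment> \<open>The right-hand side uses only \<open>u\<close> and the group operations, so
    \<open>\<sigma>\<close> transports it.\<close>
  have stab: "stabilizer G mobius_act s = {g \<in> carrier G. g \<otimes>\<^bsub>G\<^esub> u \<otimes>\<^bsub>G\<^esub> inv\<^bsub>G\<^esub> g \<otimes>\<^bsub>G\<^esub> u = u \<otimes>\<^bsub>G\<^esub> (g \<otimes>\<^bsub>G\<^esub> u \<otimes>\<^bsub>G\<^esub> inv\<^bsub>G\<^esub> g)}"
    if u: "u = mat 1 + nilp s l" "l \<noteq> 0" for u s l
  proof -
    have "fixform g s = 0 \<longleftrightarrow>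
       g \<otimes>\<^bsub>G\<^esub> u \<otimes>\<^bsub>G\<^esub> inv\<^bsub>G\<^esub> g \<otimes>\<^bsub>G\<^esub> u = u \<otimes>\<^bsub>G\<^esub> (g \<otimes>\<^bsub>G\<^esub> u \<otimes>\<^bsub>G\<^esub> inv\<^bsub>G\<^esub> g)" if "g \<in> carrier G" for g
      using conj_unipotent_commute_iff[of g "inv\<^bsub>G\<^esub> g" l s] G.r_inv[OF that] u
      by (simp add: G_def GL2_simps)
    then show ?thesis
      unfolding G_def stabilizer_GL2 by auto
  qed
  obtain l where l: "l \<noteq> 0" "mat 1 + nilp s l \<in> carrier G"
    using unipotent_in_GL2[OF frac] unfolding G_def by metis
  define u where "u = mat 1 + nilp s l"
  have nz: "nilp s l \<noteq> 0" if "l \<noteq> 0" for s and l :: 'k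
    using that by (cases s) (auto simp: vec_eq_iff forall_2)
  have u: "u \<in> carrier G" "u \<noteq> \<one>\<^bsub>G\<^esub>"
    using l nz[OF l(1)] by (auto simp: u_def G_def GL2_simps)
  have "u [^]\<^bsub>G\<^esub> CHAR('k) = \<one>\<^bsub>G\<^esub>"
  proof -
    \<comment> \<open>The nilpotent part squares to 0, so powers of \<open>u\<close> just multiply
      \<open>l\<close> by the exponent.\<close>
    have "u [^]\<^bsub>G\<^esub> (k::nat) = mat 1 + nilp s (of_nat k * l)" for k
    proof (induction k)
      case 0
      have "nilp s 0 = 0" by (cases s) (auto simp: vec_eq_iff forall_2)
      then show ?case by (simp add: G_def GL2_simps nat_pow_def)
    next
      case (Suc k)
      then show ?case
        by (cases s) (simp_all add: G_def GL2_simps nat_pow_def u_def mat_m2 m2_add algebra_simps power2_eq_square)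
    qed
    moreover have "nilp s 0 = 0" by (cases s) (auto simp: vec_eq_iff forall_2)
    ultimately show ?thesis by (simp add: G_def GL2_simps)
  qed
  then have "\<sigma> u [^]\<^bsub>G\<^esub> CHAR('k) = \<one>\<^bsub>G\<^esub>"
    using hom_nat_pow[OF u(1), of "CHAR('k)"] by simp
  then have pow: "mpoly ([:1, 1:] ^ CHAR('k)) (\<sigma> u - mat 1) = mat 1"
    using GL2_pow[of "\<sigma> u - mat 1" "CHAR('k)"] by (simp add: G_def GL2_simps)
  have "\<sigma> u \<noteq> \<one>\<^bsub>G\<^esub>"
    using u bij by (metis G.one_closed bij_betw_def hom_one inj_onD)
  then have "\<sigma> u - mat 1 \<noteq> 0" by (simp add: G_def GL2_simps)
  then obtain s' l' where s': "l' \<noteq> 0" "\<sigma> u - mat 1 = nilp s' l'"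
    by (rule nilp_if_power_char[OF char _ pow])
  then have u': "\<sigma> u = mat 1 + nilp s' l'" by (simp add: algebra_simps)
  have image: "\<sigma> ` {g \<in> carrier G. P g} = {g \<in> carrier G. Q g}"
    if "\<And>g. g \<in> carrier G \<Longrightarrow> Q (\<sigma> g) \<longleftrightarrow> P g" for P Q
  proof -
    have "{g \<in> carrier G. Q g} = {g \<in> \<sigma> ` carrier G. Q g}"
      by (simp only: bij_betw_imp_surj_on[OF bij])
    also have "\<dots> = \<sigma> ` {g \<in> carrier G. P g}"
      using that by auto
    finally show ?thesis ..
  qed
  have "\<sigma> ` stabilizer G mobius_act s = stabilizer G mobius_act s'"
    unfolding stab[OF u_def l(1)] stab[OF u' s'(1)]
  proof (rule image)
    fix g assume g: "g \<in> carrier G"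
    have "\<sigma> (g \<otimes>\<^bsub>G\<^esub> u \<otimes>\<^bsub>G\<^esub> inv\<^bsub>G\<^esub> g \<otimes>\<^bsub>G\<^esub> u) = \<sigma> (u \<otimes>\<^bsub>G\<^esub> (g \<otimes>\<^bsub>G\<^esub> u \<otimes>\<^bsub>G\<^esub> inv\<^bsub>G\<^esub> g)) \<longleftrightarrow>
       g \<otimes>\<^bsub>G\<^esub> u \<otimes>\<^bsub>G\<^esub> inv\<^bsub>G\<^esub> g \<otimes>\<^bsub>G\<^esub> u = u \<otimes>\<^bsub>G\<^esub> (g \<otimes>\<^bsub>G\<^esub> u \<otimes>\<^bsub>G\<^esub> inv\<^bsub>G\<^esub> g)"
      by (rule inj_on_eq_iff[OF bij_betw_imp_inj_on[OF bij]]) (use g u in auto)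
    then show "\<sigma> g \<otimes>\<^bsub>G\<^esub> \<sigma> u \<otimes>\<^bsub>G\<^esub> inv\<^bsub>G\<^esub> \<sigma> g \<otimes>\<^bsub>G\<^esub> \<sigma> u =
        \<sigma> u \<otimes>\<^bsub>G\<^esub> (\<sigma> g \<otimes>\<^bsub>G\<^esub> \<sigma> u \<otimes>\<^bsub>G\<^esub> inv\<^bsub>G\<^esub> \<sigma> g) \<longleftrightarrow>
      g \<otimes>\<^bsub>G\<^esub> u \<otimes>\<^bsub>G\<^esub> inv\<^bsub>G\<^esub> g \<otimes>\<^bsub>G\<^esub> u = u \<otimes>\<^bsub>G\<^esub> (g \<otimes>\<^bsub>G\<^esub> u \<otimes>\<^bsub>G\<^esub> inv\<^bsub>G\<^esub> g)"
      using g u by simp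
  qed
  then show ?thesis unfolding G_def by blast
qed

end

section \<open>Function fields in the sense of HOL-Algebra\<close>

lemma field_ring_simps:
  "carrier (field_ring :: 'k::field ring) = UNIV"
  "x \<otimes>\<^bsub>(field_ring :: 'k::field ring)\<^esub> y = x * y" "x \<oplus>\<^bsub>(field_ring :: 'k::field ring)\<^esub> y = x + y"
  "\<one>\<^bsub>(field_ring :: 'k::field ring)\<^esub> = 1" "\<zero>\<^bsub>(field_ring :: 'k::field ring)\<^esub> = 0"
  by (simp_all add: ring_of_type_algebra_def)

lemma field_ring_a_inv: "\<ominus>\<^bsub>(field_ring :: 'k::field ring)\<^esub> x = - x"
proof -
  interpret field "field_ring :: 'k ring" by (rule field_from_type_algebra)
  show ?thesis by (rule minus_equality) (simp_all add: field_ring_simps)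
qed

lemma field_ring_m_inv: "x \<noteq> 0 \<Longrightarrow> inv\<^bsub>(field_ring :: 'k::field ring)\<^esub> x = inverse x"
proof -
  interpret field "field_ring :: 'k ring" by (rule field_from_type_algebra)
  show "x \<noteq> 0 \<Longrightarrow> inv\<^bsub>(field_ring :: 'k ring)\<^esub> x = inverse x"
    by (rule comm_inv_char) (simp_all add: field_ring_simps)
qed

lemma ring_set_if_subring:
  assumes "subring V (field_ring :: 'k::field ring)"
  shows "ring_set V"
proof -
  note * = subringE[OF assms, unfolded field_ring_simps field_ring_a_inv]
  have "x - y \<in> V" if "x \<in> V" "y \<in> V" for x y
    using *(7)[OF that(1) *(5)[OF that(2)]] by simp
  then show ?thesis unfolding ring_set_def using *(3,6) by blast
qed

lemma finite_constants_if_subfield: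
  assumes "subfield F (field_ring :: 'k::field ring)" "finite F"
  shows "finite_constants F"
proof
  interpret field "field_ring :: 'k ring" by (rule field_from_type_algebra)
  show ring: "ring_set F" using subfieldE(1)[OF assms(1)] by (rule ring_set_if_subring)
  show "inverse a \<in> F" if "a \<in> F" for a
  proof (cases "a = 0")
    case True
    then show ?thesis using ring_set_closed(1)[OF ring] by simp
  next
    case False
    then show ?thesis
      using subfield_m_inv(1)[OF assms(1), of a] that by (simp add: field_ring_simps field_ring_m_inv)
  qed
qed (fact assms(2))

text \<open>\<open>dimension\<close> adjoins one vector at a time, and these vectors form
  \<open>b\<close>. The 0 in \<open>insert 0 E\<close> is the default value of the
  coefficients.\<close>

lemma dimension_spanning:
  assumes "ring.dimension (field_ring :: 'k::field ring) n E Y"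
  shows "\<exists>b. \<forall>y\<in>Y. \<exists>r. (\<forall>j. r j \<in> insert 0 E) \<and> y = (\<Sum>j<n. r j * b j)"
proof -
  interpret field "field_ring :: 'k ring" by (rule field_from_type_algebra)
  show ?thesis
    using assms
  proof (induction rule: dimension.induct)
    case (zero_dim K)
    show ?case by (auto simp: field_ring_simps intro!: exI[of _ "\<lambda>_. 0"])
  next
    case (Suc_dim v Y n K)
    then obtain b where b: "\<And>y. y \<in> Y \<Longrightarrow> \<exists>r. (\<forall>j. r j \<in> insert 0 K) \<and> y = (\<Sum>j<n. r j * b j)"
      by blast
    have "\<exists>r. (\<forall>j. r j \<in> insert 0 K) \<and> y = (\<Sum>j<Suc n. r j * (b(n := v)) j)"
      if ext: "y \<in> line_extension K v Y" for y
    proof -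
      obtain a y' where y: "a \<in> K" "y' \<in> Y" "y = a * v + y'"
        using ext by (auto simp: line_extension_mem_iff field_ring_simps)
      obtain r where r: "\<And>j. r j \<in> insert 0 K" "y' = (\<Sum>j<n. r j * b j)"
        using b[OF y(2)] by blast
      have "y = (\<Sum>j<Suc n. (r(n := a)) j * (b(n := v)) j)"
        unfolding y(3) r(2) by (simp add: add.commute)
      moreover have "\<forall>j. (r(n := a)) j \<in> insert 0 K" using r(1) y(1) by auto
      ultimately show ?thesis by blast
    qed
    then show ?case by blast
  qed
qed

context finite_constants
begin

lemma generate_field_subset_ratl: "generate_field field_ring (insert x F) \<subseteq> ratl x"
proof
  fix a assume "a \<in> generate_field field_ring (insert x F)"
  then show "a \<in> ratl x"
    by induction
      (auto simp: field_ring_simps field_ring_a_inv field_ring_m_inv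
        intro: ratl_closed inverse_in_ratl F_in_ratl base_in_ratl)
qed

lemma ratl_common_denominator:
  fixes r :: "nat \<Rightarrow> 'k"
  assumes "\<And>j. r j \<in> ratl x"
  shows "\<exists>q p. q \<in> polys_over F \<and> poly q x \<noteq> 0 \<and> (\<forall>j. p j \<in> polys_over F) \<and>
    (\<forall>j<d. poly q x * r j = poly (p j) x)"
proof (induction d)
  case 0
  show ?case by (intro exI[of _ 1] exI[of _ "\<lambda>_. 0"]) (simp add: PF_closed)
next
  case (Suc d)
  then obtain q p where q: "q \<in> polys_over F" "poly q x \<noteq> 0" "\<And>j. p j \<in> polys_over F"
    "\<And>j. j < d \<Longrightarrow> poly q x * r j = poly (p j) x" by blast
  obtain f g where fg: "f \<in> polys_over F" "g \<in> polys_over F" "poly g x \<noteq> 0" "r d = poly f x / poly g x"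
    using assms[of d] by (auto simp: ratl_def)
  define p' where "p' j = (if j = d then q * f else g * p j)" for j
  have "poly (q * g) x * r j = poly (p' j) x" if "j < Suc d" for j
  proof (cases "j = d")
    case True
    then show ?thesis using fg(3) by (simp add: p'_def fg(4))
  next
    case False
    then have "poly q x * r j = poly (p j) x" using that q(4) by simp
    then show ?thesis using False by (simp add: p'_def mult_ac)
  qed
  moreover have "q * g \<in> polys_over F" "poly (q * g) x \<noteq> 0" "\<forall>j. p' j \<in> polys_over F"
    using q fg by (auto simp: p'_def intro: PF_closed)
  ultimately show ?case by blast
qed

end

text \<open>A spanning family over the generated field \<open>F(x)\<close> becomes \<open>b\<close>;
  a common denominator of the coefficients gives the form required by \<open>span\<close>.\<close>

lemma function_field_if_constants:
  fixes F :: "'k::field set"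
  assumes "function_field_with_constants F" "finite F"
  obtains x b d where "function_field F x b d"
proof -
  interpret finite_constants F
    using assms by (intro finite_constants_if_subfield) (auto simp: function_field_with_constants_def)
  interpret K: field "field_ring :: 'k ring" by (rule field_from_type_algebra)
  obtain x d where "K.dimension d (generate_field field_ring (insert x F)) UNIV"
    using assms(1) by (auto simp: function_field_with_constants_def K.finite_dimension_def)
  from dimension_spanning[OF this] obtain b where
    b: "\<And>y. \<exists>r. (\<forall>j. r j \<in> insert 0 (generate_field field_ring (insert x F))) \<and> y = (\<Sum>j<d. r j * b j)"
    by blast
  have "function_field F x b d"
  proof
    fix y
    obtain r where r: "\<And>j. r j \<in> insert 0 (generate_field field_ring (insert x F))" "y = (\<Sum>j<d. r j * b j)"
      using b[of y] by blast
    have "r j \<in> ratl x" for j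
      using r(1)[of j] subsetD[OF generate_field_subset_ratl[of x], of "r j"] ratl_closed(1)[of x] by auto
    then obtain q p where q: "q \<in> polys_over F" "poly q x \<noteq> 0" "\<And>j. p j \<in> polys_over F"
      "\<And>j. j < d \<Longrightarrow> poly q x * r j = poly (p j) x"
      using ratl_common_denominator[of r x d] by blast
    have "poly q x * y = (\<Sum>j<d. poly (p j) x * b j)"
      unfolding r(2) sum_distrib_left
      by (rule sum.cong) (simp_all add: q(4)[symmetric] mult.assoc)
    with q show "\<exists>q p. q \<in> polys_over F \<and> poly q x \<noteq> 0 \<and> (\<forall>j. p j \<in> polys_over F) \<and>
        poly q x * y = (\<Sum>j<d. poly (p j) x * b j)"
      by blast
  qed
  then show thesis by (rule that)
qed

text \<open>The finite set \<open>F\<close> contains all \<open>of_nat n\<close>, so two of them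
  coincide and the characteristic is positive.\<close>

lemma (in finite_constants) prime_char: "Factorial_Ring.prime CHAR('k)"
proof -
  have "\<not> inj (of_nat :: nat \<Rightarrow> 'k)"
  proof
    assume "inj (of_nat :: nat \<Rightarrow> 'k)"
    moreover have "range (of_nat :: nat \<Rightarrow> 'k) \<subseteq> F"
    proof clarify
      fix n show "(of_nat n :: 'k) \<in> F"
        by (induction n) (auto intro: F_closed)
    qed
    ultimately show False
      using finite_F infinite_UNIV_nat finite_imageD finite_subset by blast
  qed
  then obtain m n where "m < n" "(of_nat m :: 'k) = of_nat n"
    by (metis injI linorder_neqE_nat)
  then have "(of_nat (n - m) :: 'k) = 0" "n - m > 0"
    by (simp_all add: of_nat_diff)
  then have "CHAR('k) > 0" unfolding CHAR_pos_iff by blast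
  then show ?thesis by (rule prime_CHAR_semidom)
qed

text \<open>The elements outside a valuation ring are the inverses of its nonzero nonunits. Hence
  places correspond to valuation rings.\<close>

lemma (in finite_constants) nonunits_inj:
  assumes "valring V" "valring W" "nonunits V = nonunits W"
  shows "V = W"
proof -
  have "V \<subseteq> W" if V: "valring V" and W: "valring W" and eq: "nonunits V = nonunits W" for V W
  proof
    fix x assume "x \<in> V"
    show "x \<in> W"
    proof (rule ccontr)
      assume "x \<notin> W"
      then have "x \<noteq> 0" "inverse x \<in> nonunits V" using inverse_in_nonunits[OF W] eq by auto
      with \<open>x \<in> V\<close> show False by (simp add: nonunits_iff[OF V])
    qed
  qed
  with assms show ?thesis by blast
qed

lemma (in finite_constants) valring_if_valuation_ring: "valuation_ring F V \<Longrightarrow> valring V"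
  by (auto simp: valuation_ring_def valring_def ring_set_if_subring)

lemma (in finite_constants) regular_away_from_eq:
  assumes V: "valuation_ring F V"
  shows "regular_away_from F (nonunits V) = \<Inter>{W. valuation_ring F W \<and> W \<noteq> V}"
  using V nonunits_inj[OF valring_if_valuation_ring valring_if_valuation_ring]
  unfolding regular_away_from_def place_def regular_at_def by (safe; blast)

theorem theorem1p3:
  fixes F :: "'k::field set"
    and Pinf :: "'k set"
    and \<sigma> :: "'k ^ 2 ^ 2 \<Rightarrow> 'k ^ 2 ^ 2"
  assumes "finite F"
    and "function_field_with_constants F"
    and "place F Pinf"
    and "\<sigma> \<in> auto (GL2 (regular_away_from F Pinf))"
  shows "\<forall>s :: 'k proj_line. \<exists>s' :: 'k proj_line.
           \<sigma> ` stabilizer (GL2 (regular_away_from F Pinf)) mobius_act s =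
           stabilizer (GL2 (regular_away_from F Pinf)) mobius_act s'"
proof -
  obtain x b d where "function_field F x b d"
    using function_field_if_constants[OF assms(2,1)] .
  then interpret function_field F x b d .
  obtain V where V: "valuation_ring F V" "Pinf = nonunits V"
    using assms(3) by (auto simp: place_def)
  define A where "A = regular_away_from F Pinf"
  have A: "A = \<Inter>{W. valuation_ring F W \<and> W \<noteq> V}"
    unfolding A_def V(2) by (rule regular_away_from_eq[OF V(1)])
  have "ring_set W" if "valuation_ring F W" for W
    using ring_V[OF valring_if_valuation_ring[OF that]] .
  then have "ring_set A"
    unfolding A ring_set_def by blast
  moreover have "\<exists>a\<in>A. \<exists>c\<in>A. c \<noteq> 0 \<and> y * c = a" for y
  proof -
    have "V \<noteq> UNIV" using V(1) by (auto simp: valuation_ring_def)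
    from regular_fraction[OF valring_if_valuation_ring[OF V(1)] this, of y]
    obtain a c where ac: "a \<in> \<Inter>{W. valring W \<and> W \<noteq> V}" "c \<in> \<Inter>{W. valring W \<and> W \<noteq> V}"
      "c \<noteq> 0" "y * c = a"
      by blast
    \<comment> \<open>\<open>A\<close> is the intersection over the smaller family of proper
      valuation rings, so it contains this one.\<close>
    have "\<Inter>{W. valring W \<and> W \<noteq> V} \<subseteq> A"
      unfolding A by (rule Inter_anti_mono) (auto intro: valring_if_valuation_ring)
    with ac show ?thesis by (metis subsetD)
  qed
  ultimately show ?thesis
    using auto_GL2_stabilizer[of A] prime_char assms(4) unfolding A_def[symmetric] by blast
qed

end
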